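(* Let $\mathbb{K}$ be a field and let $p,q,\lambda,\mu\in\mathbb{K}^{\ast}$ be such that neither $p$ nor $q$ is a root of unity. Then the height-one prime ideals of $\mathcal{A}_p(\lambda,\mu,\mathbb{K}_q[s,t])$ are exactly the two-sided ideals $(z)$, $(s)$ and $(t)$.
   Context: For a field $\mathbb{K}$ and $p,q,\lambda,\mu\in\mathbb{K}^{\ast}$, $\mathcal{A}_p(\lambda,\mu,\mathbb{K}_q[s,t])$ denotes the associative unital $\mathbb{K}$-algebra generated by $x,y,s,t$ subject to the relations $$xy-pyx=1,\quad st=qts,\quad sx=\lambda xs,\quad sy=\lambda^{-1}ys,\quad tx=\mu xt,\quad ty=\mu^{-1}yt.$$ Put $z:=xy-yx$. For an element $u$, $(u)$ denotes the two-sided ideal generated by $u$. The number $1$ counts as a root of unity. *)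

theory Defs
  imports
    "HOL-Algebra.QuotRing"
    "HOL-Algebra.Ideal_Product"
    "HOL-Library.Poly_Mapping"
    "HOL-Library.Extended_Nat"
begin

section \<open>Prime ideals and height in noncommutative rings\<close>

text \<open>
  The locale \<open>primeideal\<close> of HOL-Algebra is for commutative rings and is elementwise
  (completely prime). Here primeness is the noncommutative notion, stated on products of
  two-sided ideals.
\<close>

definition nc_prime_ideal :: "'a set \<Rightarrow> ('a, 'b) ring_scheme \<Rightarrow> bool" where
  "nc_prime_ideal P R \<longleftrightarrow>
     ideal P R \<and> P \<noteq> carrier R \<and>
     (\<forall>I J. ideal I R \<longrightarrow> ideal J R \<longrightarrow> I \<cdot>\<^bsub>R\<^esub> J \<subseteq> P \<longrightarrow> I \<subseteq> P \<or> J \<subseteq> P)"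

text \<open>
  The supremum of the lengths \<open>n\<close> of strict chains \<open>C 0 \<subset> C 1 \<subset> \<dots> \<subset> C n = P\<close> of prime ideals.
\<close>

definition ideal_height :: "('a, 'b) ring_scheme \<Rightarrow> 'a set \<Rightarrow> enat" where
  "ideal_height R P =
     Sup {enat n | n. \<exists>C :: nat \<Rightarrow> 'a set.
            (\<forall>i\<le>n. nc_prime_ideal (C i) R) \<and> (\<forall>i<n. C i \<subset> C (Suc i)) \<and> C n = P}"


section \<open>Free associative unital algebras\<close>

datatype 'g free_monoid = Word (letters: "'g list")

text \<open>
  The free monoid is written additively, because the multiplication on finitely supported
  functions is the convolution product with respect to addition of the exponents.
\<close>

instantiation free_monoid :: (type) monoid_add
begin

definition zero_free_monoid :: "'a free_monoid" where
  "0 = Word []"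

definition plus_free_monoid :: "'a free_monoid \<Rightarrow> 'a free_monoid \<Rightarrow> 'a free_monoid" where
  "u + v = Word (letters u @ letters v)"

instance
  by standard (simp_all add: zero_free_monoid_def plus_free_monoid_def)

end

definition free_algebra :: "('g free_monoid \<Rightarrow>\<^sub>0 'k::field) ring" where
  "free_algebra = \<lparr>carrier = UNIV, monoid.mult = (*), one = 1, zero = 0, add = (+)\<rparr>"

definition free_gen :: "'g \<Rightarrow> ('g free_monoid \<Rightarrow>\<^sub>0 'k::field)" where
  "free_gen g = Poly_Mapping.single (Word [g]) 1"

definition free_const :: "'k \<Rightarrow> ('g free_monoid \<Rightarrow>\<^sub>0 'k::field)" where
  "free_const c = Poly_Mapping.single 0 c"

lemma ring_free_algebra: "ring (free_algebra :: ('g free_monoid \<Rightarrow>\<^sub>0 'k::field) ring)"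
proof (rule ringI)
  show "abelian_group (free_algebra :: ('g free_monoid \<Rightarrow>\<^sub>0 'k) ring)"
    by (rule abelian_groupI)
      (auto simp: free_algebra_def add.assoc add.commute intro: exI[of _ "- x" for x])
  show "monoid (free_algebra :: ('g free_monoid \<Rightarrow>\<^sub>0 'k) ring)"
    by (rule monoidI) (auto simp: free_algebra_def mult.assoc)
qed (auto simp: free_algebra_def algebra_simps)


section \<open>The algebra $\mathcal{A}_p(\lambda,\mu,\mathbb{K}_q[s,t])$\<close>

datatype gen = X | Y | S | T

text \<open>A relation \<open>u = v\<close> is encoded as the element \<open>u - v\<close> of the free algebra.\<close>

definition relators :: "'k \<Rightarrow> 'k \<Rightarrow> 'k \<Rightarrow> 'k \<Rightarrow> (gen free_monoid \<Rightarrow>\<^sub>0 'k::field) set" where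
  "relators p q l m =
    (let x = free_gen X; y = free_gen Y; s = free_gen S; t = free_gen T; c = free_const in
     {x * y - c p * y * x - 1,
      s * t - c q * t * s,
      s * x - c l * x * s,
      s * y - c (inverse l) * y * s,
      t * x - c m * x * t,
      t * y - c (inverse m) * y * t})"

definition rel_ideal :: "'k \<Rightarrow> 'k \<Rightarrow> 'k \<Rightarrow> 'k \<Rightarrow> (gen free_monoid \<Rightarrow>\<^sub>0 'k::field) set" where
  "rel_ideal p q l m = Idl\<^bsub>free_algebra\<^esub> (relators p q l m)"

definition alg :: "'k \<Rightarrow> 'k \<Rightarrow> 'k \<Rightarrow> 'k \<Rightarrow> (gen free_monoid \<Rightarrow>\<^sub>0 'k::field) set ring" where
  "alg p q l m = free_algebra Quot rel_ideal p q l m"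

text \<open>
  As \<open>alg\<close> is unital, its two-sided ring ideals are closed under scalars, so they coincide with
  its two-sided algebra ideals and the scalar action need not be part of the structure.
\<close>

definition alg_gen :: "'k \<Rightarrow> 'k \<Rightarrow> 'k \<Rightarrow> 'k \<Rightarrow> gen \<Rightarrow> (gen free_monoid \<Rightarrow>\<^sub>0 'k::field) set" where
  "alg_gen p q l m g = rel_ideal p q l m +>\<^bsub>free_algebra\<^esub> free_gen g"

definition alg_z :: "'k \<Rightarrow> 'k \<Rightarrow> 'k \<Rightarrow> 'k \<Rightarrow> (gen free_monoid \<Rightarrow>\<^sub>0 'k::field) set" where
  "alg_z p q l m =
     alg_gen p q l m X \<otimes>\<^bsub>alg p q l m\<^esub> alg_gen p q l m Y
       \<ominus>\<^bsub>alg p q l m\<^esub> alg_gen p q l m Y \<otimes>\<^bsub>alg p q l m\<^esub> alg_gen p q l m X"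

lemma ideal_rel_ideal: "ideal (rel_ideal p q l m) free_algebra"
  unfolding rel_ideal_def
  by (rule ring.genideal_ideal[OF ring_free_algebra]) (simp add: free_algebra_def)

lemma ring_alg: "ring (alg p q l m)"
  unfolding alg_def by (rule ideal.quotient_is_ring[OF ideal_rel_ideal])

end

theory Submission
  imports Defs "HOL-Library.Product_Plus" "HOL-Library.Product_Lexorder"
begin

text \<open>
  The element \<open>z = xy - yx\<close> equals \<open>(p - 1) y x + 1\<close>, and moving \<open>z\<close>, \<open>s\<close> or \<open>t\<close> past a generator
  only costs a scalar, up to the relations. So \<open>z\<close>, \<open>s\<close>, \<open>t\<close> are normal elements. The theorem
  follows from two facts about the algebra \<open>A\<close>, by comparing chains of primes
  (\<open>height_one_primes_eq_principal\<close>): the ideals \<open>0\<close>, \<open>(z)\<close>, \<open>(s)\<close>, \<open>(t)\<close> are prime and none of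
  the last three contains the generator of another, and every nonzero prime contains \<open>z\<close>, \<open>s\<close> or \<open>t\<close>.

  \<^emph>\<open>The four ideals are completely prime.\<close> The algebra embeds in a quantum torus through
  \<open>y = (z - 1) x\<^sup>-\<^sup>1 / (p - 1)\<close>, and setting \<open>z\<close>, \<open>s\<close> or \<open>t\<close> to zero there models the quotients.
  The locale \<open>quotient_model\<close> treats all cases at once: three parameters \<open>\<zeta>\<close>, \<open>\<sigma>\<close>, \<open>\<tau>\<close> scale the
  action of \<open>z\<close>, \<open>s\<close>, \<open>t\<close> on the functions on the lattice of exponents, and \<open>J\<close> is the ideal of the
  free algebra generated by the relators and by those of \<open>z\<close>, \<open>s\<close>, \<open>t\<close> whose parameter is zero.
  Modulo \<open>J\<close> the reduced normal words \<open>y\<^sup>i x\<^sup>j s\<^sup>k t\<^sup>n\<close> span (\<open>span_reduced_words\<close>), and they act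
  by operators that move the leading exponent, in a lexicographic order, by pairwise distinct
  vectors. Hence every element outside \<open>J\<close> moves all leading exponents by one fixed vector
  (\<open>not_in_J_shifts_lead\<close>). Operators of this kind are closed under composition and not zero, so
  \<open>J\<close> is completely prime.

  \<^emph>\<open>Nonzero primes contain a normal generator.\<close> Let \<open>P\<close> be a nonzero prime that contains none of
  \<open>z\<close>, \<open>s\<close>, \<open>t\<close>. A power of \<open>x\<close> turns a nonzero element of \<open>P\<close> into a combination of monomials
  \<open>x\<^sup>a z\<^sup>b s\<^sup>k t\<^sup>n\<close> (\<open>clear_denominator\<close>). These monomials commute with each of \<open>x\<close>, \<open>z\<close>, \<open>s\<close>, \<open>t\<close> up to
  scalars, and because \<open>p\<close> and \<open>q\<close> are not roots of unity the four scalars determine the exponents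
  (\<open>weight_separates\<close>). The usual elimination of eigenvectors leaves one monomial in \<open>P\<close>
  (\<open>eigenvector_separation\<close>). Normality and primeness remove \<open>z\<close>, \<open>s\<close>, \<open>t\<close> from it, so a power of
  \<open>x\<close> lies in \<open>P\<close>. Commutation with \<open>y\<close> lowers that power, because the
  quantum integers \<open>(p\<^sup>n - 1) / (p - 1)\<close> do not vanish, and one arrives at \<open>1 \<in> P\<close>.

  All computation takes place in the free algebra, as congruence modulo an ideal.
\<close>

section \<open>Prime ideals of noncommutative rings\<close>

text \<open>
  The elements \<open>u\<close> with \<open>u R b \<subseteq> P\<close> form a two-sided ideal containing \<open>a\<close>, hence containing \<open>(a)\<close>; the
  same argument on the right then gives \<open>(a) (b) \<subseteq> P\<close>.
\<close>

lemma nc_prime_ideal_elementwise: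
  fixes R (structure)
  assumes R: "ring R" and P: "nc_prime_ideal P R"
    and a: "a \<in> carrier R" and b: "b \<in> carrier R"
    and ab: "\<And>r. r \<in> carrier R \<Longrightarrow> a \<otimes> r \<otimes> b \<in> P"
  shows "a \<in> P \<or> b \<in> P"
proof -
  interpret ring R by fact
  have P_ideal: "ideal P R"
    using P by (simp add: nc_prime_ideal_def)
  interpret P: ideal P R by fact
  let ?A = "Idl {a}" and ?B = "Idl {b}"
  have A: "ideal ?A R" and B: "ideal ?B R"
    using a b by (auto intro: genideal_ideal)
  interpret A: ideal ?A R by fact
  let ?L = "{u \<in> carrier R. \<forall>r\<in>carrier R. u \<otimes> r \<otimes> b \<in> P}"
  have "ideal ?L R"
  proof (rule idealI)
    show "subgroup ?L (add_monoid R)"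
      using b by unfold_locales (auto simp: l_distr l_minus simp flip: a_inv_def)
    show "x \<otimes> u \<in> ?L" if "u \<in> ?L" "x \<in> carrier R" for u x
      using that b by (auto simp: m_assoc P.I_l_closed)
    show "u \<otimes> x \<in> ?L" if "u \<in> ?L" "x \<in> carrier R" for u x
    proof -
      have "u \<otimes> x \<otimes> r \<otimes> b \<in> P" if "r \<in> carrier R" for r
        using \<open>u \<in> ?L\<close> \<open>x \<in> carrier R\<close> that by (auto simp: m_assoc[of u])
      then show ?thesis using that by auto
    qed
  qed (rule R)
  then have A_sub: "?A \<subseteq> ?L"
    by (rule genideal_minimal) (use a ab in auto)
  let ?M = "{v \<in> carrier R. \<forall>u\<in>?A. u \<otimes> v \<in> P}"
  have "ideal ?M R"
  proof (rule idealI)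
    show "subgroup ?M (add_monoid R)"
      by unfold_locales (auto simp: r_distr r_minus A.Icarr simp flip: a_inv_def)
    show "x \<otimes> v \<in> ?M" if "v \<in> ?M" "x \<in> carrier R" for v x
      using that by (auto simp: A.I_r_closed A.Icarr simp flip: m_assoc)
    show "v \<otimes> x \<in> ?M" if "v \<in> ?M" "x \<in> carrier R" for v x
      using that by (auto simp: A.Icarr P.I_r_closed simp flip: m_assoc)
  qed (rule R)
  moreover have "u \<otimes> b \<in> P" if "u \<in> ?A" for u
    using that A_sub one_closed r_one by fastforce
  ultimately have B_sub: "?B \<subseteq> ?M"
    by (intro genideal_minimal) (use b in auto)
  have "w \<in> P" if "w \<in> ?A \<cdot>\<^bsub>R\<^esub> ?B" for w
    using that by induction (use B_sub in auto)
  then have "?A \<subseteq> P \<or> ?B \<subseteq> P"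
    using P A B by (auto simp: nc_prime_ideal_def)
  then show ?thesis
    using genideal_self'[OF a] genideal_self'[OF b] by auto
qed

lemma completely_prime_imp_nc_prime_ideal:
  fixes R (structure)
  assumes "ideal P R" and "P \<noteq> carrier R"
    and ab: "\<And>a b. a \<in> carrier R \<Longrightarrow> b \<in> carrier R \<Longrightarrow> a \<otimes> b \<in> P \<Longrightarrow> a \<in> P \<or> b \<in> P"
  shows "nc_prime_ideal P R"
  unfolding nc_prime_ideal_def
proof (intro conjI allI impI)
  fix I J assume I: "ideal I R" and J: "ideal J R" and IJ: "I \<cdot>\<^bsub>R\<^esub> J \<subseteq> P"
  show "I \<subseteq> P \<or> J \<subseteq> P"
  proof (rule ccontr)
    assume "\<not> (I \<subseteq> P \<or> J \<subseteq> P)"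
    then obtain a b where "a \<in> I" "a \<notin> P" "b \<in> J" "b \<notin> P" by auto
    moreover have "a \<otimes> b \<in> P"
      using IJ ideal_prod.prod[OF \<open>a \<in> I\<close> \<open>b \<in> J\<close>] by auto
    ultimately show False
      using ab I J by (meson ideal.Icarr)
  qed
qed (use assms in auto)

text \<open>
  Order theory of primes: when every nonzero prime contains a member of \<open>N\<close>, the primes \<open>(n)\<close> are the
  minimal nonzero ones. In a chain of length two that ends in \<open>(n)\<close>, the middle prime would contain a
  member of \<open>N\<close>, necessarily \<open>n\<close>, and so be \<open>(n)\<close> itself; and a height-one prime cannot strictly
  contain some \<open>(n)\<close>, as \<open>0 \<subset> (n)\<close> is already a chain.
\<close>

lemma height_one_primes_eq_principal:
  fixes R (structure)
  assumes R: "ring R" and zero: "nc_prime_ideal {\<zero>} R"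
    and N: "N \<subseteq> carrier R" and N0: "\<zero> \<notin> N"
    and prime: "\<And>n. n \<in> N \<Longrightarrow> nc_prime_ideal (Idl {n}) R"
    and antichain: "\<And>n n'. n \<in> N \<Longrightarrow> n' \<in> N \<Longrightarrow> n \<in> Idl {n'} \<Longrightarrow> n = n'"
    and hits: "\<And>P. nc_prime_ideal P R \<Longrightarrow> P \<noteq> {\<zero>} \<Longrightarrow> \<exists>n\<in>N. n \<in> P"
  shows "{P. nc_prime_ideal P R \<and> ideal_height R P = 1} = (\<lambda>n. Idl {n}) ` N"
proof (intro subset_antisym subsetI)
  interpret ring R by fact
  define chain where "chain P n C \<longleftrightarrow>
      (\<forall>i\<le>n. nc_prime_ideal (C i) R) \<and> (\<forall>i<n. C i \<subset> C (Suc i)) \<and> C n = P" for P n C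
  have height: "ideal_height R P = Sup {enat n | n. \<exists>C. chain P n C}" for P
    by (simp add: ideal_height_def chain_def)
  have zero_in: "\<zero> \<in> P" if "nc_prime_ideal P R" for P
    using that by (simp add: nc_prime_ideal_def additive_subgroup.zero_closed ideal.axioms(1))
  have Idl_sub: "Idl {n} \<subseteq> P" if "n \<in> P" "nc_prime_ideal P R" for n P
    using that by (intro genideal_minimal) (auto simp: nc_prime_ideal_def)
  have self: "n \<in> Idl {n}" if "n \<in> N" for n
    using that N by (intro genideal_self') auto
  have zero_sub: "{\<zero>} \<subset> Idl {n}" if n: "n \<in> N" for n
  proof -
    have "n \<noteq> \<zero>" using n N0 by auto
    with self[OF n] zero_in[OF prime[OF n]] show ?thesis by auto
  qed
  fix P
  {
    assume "P \<in> {P. nc_prime_ideal P R \<and> ideal_height R P = 1}"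
    then have P: "nc_prime_ideal P R" and ht: "Sup {enat n | n. \<exists>C. chain P n C} = 1"
      by (auto simp: height)
    have "\<exists>n C. chain P n C \<and> n \<ge> 1"
    proof (rule ccontr)
      assume "\<not> ?thesis"
      then have "Sup {enat n | n. \<exists>C. chain P n C} \<le> 0"
        by (intro Sup_least) (auto simp: not_le zero_enat_def)
      then show False using ht by simp
    qed
    then obtain n C where C: "chain P n C" and n: "n \<ge> 1" by auto
    have "C (n - 1) \<subset> P" "nc_prime_ideal (C (n - 1)) R"
    proof -
      from n obtain k where "n = Suc k" by (cases n) auto
      with C show "C (n - 1) \<subset> P" "nc_prime_ideal (C (n - 1)) R"
        unfolding chain_def by auto
    qed
    then have "P \<noteq> {\<zero>}" using zero_in by blast
    then obtain g where g: "g \<in> N" "g \<in> P" using hits P by blast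
    have "Idl {g} = P"
    proof (rule ccontr)
      assume "Idl {g} \<noteq> P"
      then have "Idl {g} \<subset> P" using Idl_sub g P by blast
      moreover have "{\<zero>} \<subset> Idl {g}"
        by (rule zero_sub[OF g(1)])
      ultimately have "chain P 2 (\<lambda>i. if i = 0 then {\<zero>} else if i = 1 then Idl {g} else P)"
        unfolding chain_def using zero prime[OF g(1)] P
        by (simp add: numeral_2_eq_2 less_Suc_eq all_conj_distrib disj_imp)
      then have "enat 2 \<le> Sup {enat n | n. \<exists>C. chain P n C}"
        by (intro Sup_upper) auto
      then show False using ht by (simp add: one_enat_def)
    qed
    then show "P \<in> (\<lambda>n. Idl {n}) ` N" using g by auto
  }
  {
    assume "P \<in> (\<lambda>n. Idl {n}) ` N"
    then obtain g where g: "g \<in> N" and P: "P = Idl {g}" by auto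
    have P_prime: "nc_prime_ideal P R" using prime g P by simp
    have "{\<zero>} \<subset> P"
      unfolding P by (rule zero_sub[OF g])
    then have "chain P 1 (\<lambda>i. if i = 0 then {\<zero>} else P)"
      unfolding chain_def using zero P_prime by simp
    then have "1 \<le> Sup {enat n | n. \<exists>C. chain P n C}"
      by (intro Sup_upper) (auto simp: one_enat_def)
    moreover have "n \<le> 1" if C: "chain P n C" for n C
    proof (rule ccontr)
      assume "\<not> n \<le> 1"
      then obtain k where k: "n = Suc (Suc k)" 
        by (cases n; cases "n - 1") auto
      have steps: "\<forall>i<n. C i \<subset> C (Suc i)" and primes: "\<forall>i\<le>n. nc_prime_ideal (C i) R"
        and "C n = P"
        using C by (simp_all add: chain_def)
      have sub: "C k \<subset> C (Suc k)" "C (Suc k) \<subset> P"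
        using steps[rule_format, of k] steps[rule_format, of "Suc k"] \<open>C n = P\<close> by (simp_all add: k)
      have pr: "nc_prime_ideal (C k) R" "nc_prime_ideal (C (Suc k)) R"
        using primes by (simp_all add: k)
      have "C (Suc k) \<noteq> {\<zero>}" using zero_in[OF pr(1)] sub(1) by auto
      then obtain h where h: "h \<in> N" "h \<in> C (Suc k)" using hits pr by blast
      then have "h = g" using antichain g sub P by blast
      then show False using Idl_sub[OF h(2) pr(2)] sub P by blast
    qed
    then have "Sup {enat n | n. \<exists>C. chain P n C} \<le> 1"
      by (intro Sup_least) (auto simp: one_enat_def)
    ultimately show "P \<in> {P. nc_prime_ideal P R \<and> ideal_height R P = 1}"
      using P_prime by (simp add: height)
  }
qed

section \<open>Computing in the free algebra modulo an ideal\<close>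

text \<open>
  The free algebra as a vector space, so that spans are available for it.
\<close>

definition scl :: "'k \<Rightarrow> ('g free_monoid \<Rightarrow>\<^sub>0 'k::field) \<Rightarrow> ('g free_monoid \<Rightarrow>\<^sub>0 'k)" where
  "scl c f = free_const c * f"

lemma sum_single_lookup: "(\<Sum>w\<in>Poly_Mapping.keys f. Poly_Mapping.single w (Poly_Mapping.lookup f w)) = f"
  by (rule poly_mapping_eqI) (auto simp: lookup_sum lookup_single when_def in_keys_iff)

lemma poly_mapping_single_induct [case_names single add]:
  fixes f :: "'a \<Rightarrow>\<^sub>0 'b::comm_monoid_add"
  assumes "\<And>w c. Q (Poly_Mapping.single w c)"
    and "\<And>f g. Q f \<Longrightarrow> Q g \<Longrightarrow> Q (f + g)"
  shows "Q f"
proof -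
  have "Q (\<Sum>w\<in>A. Poly_Mapping.single w (Poly_Mapping.lookup f w))" if "finite A" for A
    using that by induction (use assms assms(1)[of undefined 0] in auto)
  from this[of "Poly_Mapping.keys f"] show ?thesis by (simp add: sum_single_lookup)
qed

lemma free_const_central: "f * free_const c = free_const c * f"
  by (induction f rule: poly_mapping_single_induct)
    (simp_all add: free_const_def mult_single mult.commute distrib_left distrib_right)

lemma scl_mult_left [simp]: "scl c f * g = scl c (f * g)"
  by (simp add: scl_def mult.assoc)

lemma scl_mult_right [simp]: "f * scl c g = scl c (f * g)"
  unfolding scl_def by (metis mult.assoc free_const_central)

global_interpretation FA: vector_space "scl :: 'k::field \<Rightarrow> ('g free_monoid \<Rightarrow>\<^sub>0 'k) \<Rightarrow> _"
proof
  fix a b :: 'k and x y :: "'g free_monoid \<Rightarrow>\<^sub>0 'k"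
  show "scl a (x + y) = scl a x + scl a y" by (simp add: scl_def distrib_left)
  show "scl (a + b) x = scl a x + scl b x" by (simp add: scl_def free_const_def single_add distrib_right)
  show "scl a (scl b x) = scl (a * b) x"
    by (simp add: scl_def free_const_def mult_single flip: mult.assoc)
  show "scl 1 x = x" by (simp add: scl_def free_const_def)
qed

text \<open>
  Elements are built by left multiplication with single generators. This is the form that suits
  statements about left ideals and left module spans.
\<close>

lemma free_algebra_induct [case_names one gen scl add]:
  assumes one: "Q 1" and gen: "\<And>g f. Q f \<Longrightarrow> Q (free_gen g * f)"
    and scl: "\<And>c f. Q f \<Longrightarrow> Q (scl c f)"
    and add: "\<And>f g. Q f \<Longrightarrow> Q g \<Longrightarrow> Q (f + g)"
  shows "Q f"
proof (induction f rule: poly_mapping_single_induct)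
  case (single w c)
  have "Q (Poly_Mapping.single (Word ws) 1)" for ws
  proof (induction ws)
    case Nil
    then show ?case using one by (simp flip: zero_free_monoid_def)
  next
    case (Cons g ws)
    have "Poly_Mapping.single (Word (g # ws)) 1 = free_gen g * Poly_Mapping.single (Word ws) (1::'b)"
      by (simp add: free_gen_def mult_single plus_free_monoid_def)
    then show ?case using gen[OF Cons] by simp
  qed
  from scl[OF this[of "letters w"], of c] show ?case
    by (simp add: scl_def free_const_def mult_single)
qed (rule add)

text \<open>
  The arithmetic of the quotient by \<open>I\<close> is carried out as a congruence on representatives, which
  keeps the type class structure of the free algebra at hand.
\<close>

locale falg_ideal =
  fixes I :: "('g free_monoid \<Rightarrow>\<^sub>0 'k::field) set"
  assumes I: "ideal I free_algebra"
begin

lemma zero_mem: "0 \<in> I"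
  using additive_subgroup.zero_closed[OF ideal.axioms(1)[OF I]] by (simp add: free_algebra_def)

lemma add_mem: "f \<in> I \<Longrightarrow> g \<in> I \<Longrightarrow> f + g \<in> I"
  using additive_subgroup.a_closed[OF ideal.axioms(1)[OF I]] by (simp add: free_algebra_def)

lemma mult_mem_left: "f \<in> I \<Longrightarrow> g * f \<in> I"
  using ideal.I_l_closed[OF I] by (simp add: free_algebra_def)

lemma mult_mem_right: "f \<in> I \<Longrightarrow> f * g \<in> I"
  using ideal.I_r_closed[OF I] by (simp add: free_algebra_def)

lemma scl_mem: "f \<in> I \<Longrightarrow> scl c f \<in> I"
  by (simp add: scl_def mult_mem_left)

lemma scl_mem_iff: "c \<noteq> 0 \<Longrightarrow> scl c f \<in> I \<longleftrightarrow> f \<in> I"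
  using scl_mem[of f c] scl_mem[of "scl c f" "inverse c"] by auto

lemma uminus_mem: "f \<in> I \<Longrightarrow> - f \<in> I"
  using mult_mem_left[of f "-1"] by simp

lemma diff_mem: "f \<in> I \<Longrightarrow> g \<in> I \<Longrightarrow> f - g \<in> I"
  using add_mem[OF _ uminus_mem, of f g] by simp

lemma sum_mem: "(\<And>i. i \<in> A \<Longrightarrow> h i \<in> I) \<Longrightarrow> sum h A \<in> I"
  by (induction A rule: infinite_finite_induct) (auto intro: zero_mem add_mem)

definition eqv (infix "\<approx>" 50) where "f \<approx> g \<longleftrightarrow> f - g \<in> I"

lemma eqv_refl [simp]: "f \<approx> f"
  by (simp add: eqv_def zero_mem)

lemma eqv_sym: "f \<approx> g \<Longrightarrow> g \<approx> f"
  unfolding eqv_def using uminus_mem by fastforce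

lemma eqv_trans [trans]: "f \<approx> g \<Longrightarrow> g \<approx> h \<Longrightarrow> f \<approx> h"
  unfolding eqv_def using add_mem[of "f - g" "g - h"] by simp

lemma eqv_add: "f \<approx> g \<Longrightarrow> f' \<approx> g' \<Longrightarrow> f + f' \<approx> g + g'"
  unfolding eqv_def using add_mem[of "f - g" "f' - g'"] by (simp add: algebra_simps)

lemma eqv_diff: "f \<approx> g \<Longrightarrow> f' \<approx> g' \<Longrightarrow> f - f' \<approx> g - g'"
  unfolding eqv_def using diff_mem[of "f - g" "f' - g'"] by (simp add: algebra_simps)

lemma eqv_mult_left: "f \<approx> g \<Longrightarrow> h * f \<approx> h * g"
  unfolding eqv_def using mult_mem_left[of "f - g" h] by (simp add: algebra_simps)

lemma eqv_mult_right: "f \<approx> g \<Longrightarrow> f * h \<approx> g * h"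
  unfolding eqv_def using mult_mem_right[of "f - g" h] by (simp add: algebra_simps)

lemma eqv_scl: "f \<approx> g \<Longrightarrow> scl c f \<approx> scl c g"
  unfolding scl_def by (rule eqv_mult_left)

lemma eqv_sum: "(\<And>i. i \<in> A \<Longrightarrow> h i \<approx> h' i) \<Longrightarrow> sum h A \<approx> sum h' A"
  unfolding eqv_def using sum_mem[of A "\<lambda>i. h i - h' i"] by (simp add: sum_subtractf)

lemma eqv_mem_iff: "f \<approx> g \<Longrightarrow> f \<in> I \<longleftrightarrow> g \<in> I"
  unfolding eqv_def using add_mem[of "f - g" g] diff_mem[of f "f - g"] by auto

lemma eqv_zero_iff: "f \<approx> 0 \<longleftrightarrow> f \<in> I"
  by (simp add: eqv_def)

text \<open>
  \<open>quasi g f c\<close> says that \<open>g\<close> commutes with \<open>f\<close> modulo \<open>I\<close> up to the scalar \<open>c\<close>. The scalar is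
  multiplicative in \<open>f\<close>, so the scalars of monomials follow from those of the generators.
\<close>

definition quasi where "quasi g f c \<longleftrightarrow> g * f \<approx> scl c (f * g)"

lemma quasi_one: "quasi g 1 1"
  by (simp add: quasi_def)

lemma quasi_self: "quasi g g 1"
  by (simp add: quasi_def)

lemma quasi_mult:
  assumes "quasi g a c" "quasi g b d"
  shows "quasi g (a * b) (c * d)"
proof -
  have "g * (a * b) = (g * a) * b" by (simp add: mult.assoc)
  also have "\<dots> \<approx> scl c (a * g) * b"
    by (rule eqv_mult_right) (use assms in \<open>simp add: quasi_def\<close>)
  also have "\<dots> = scl c (a * (g * b))" by (simp add: mult.assoc)
  also have "\<dots> \<approx> scl c (a * scl d (b * g))"
    by (intro eqv_scl eqv_mult_left) (use assms in \<open>simp add: quasi_def\<close>)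
  finally show ?thesis by (simp add: quasi_def mult.assoc)
qed

lemma quasi_power: "quasi g a c \<Longrightarrow> quasi g (a ^ n) (c ^ n)"
  by (induction n) (auto intro: quasi_one quasi_mult)

lemma quasi_sym:
  assumes "quasi g a c" "c \<noteq> 0"
  shows "quasi a g (inverse c)"
proof -
  have "scl (inverse c) (g * a) \<approx> scl (inverse c) (scl c (a * g))"
    by (rule eqv_scl) (use assms in \<open>simp add: quasi_def\<close>)
  then show ?thesis using assms by (simp add: quasi_def eqv_sym)
qed

lemma quasi_diff:
  assumes "quasi g a c" "quasi g b c"
  shows "quasi g (a - b) c"
  using eqv_diff[OF assms[unfolded quasi_def]]
  by (simp add: quasi_def right_diff_distrib left_diff_distrib FA.scale_right_diff_distrib)

lemma span_eqv:
  assumes "f \<approx> g" "g \<in> FA.span (B \<union> I)"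
  shows "f \<in> FA.span (B \<union> I)"
proof -
  have "f - g \<in> FA.span (B \<union> I)" using assms(1) by (auto simp: eqv_def intro: FA.span_base)
  from FA.span_add[OF this assms(2)] show ?thesis by simp
qed

lemma span_mem: "f \<in> I \<Longrightarrow> f \<in> FA.span (B \<union> I)"
  by (simp add: FA.span_base)

lemma span_mult_left:
  assumes "f \<in> FA.span (B \<union> I)" and "\<And>b. b \<in> B \<Longrightarrow> g * b \<in> FA.span (B \<union> I)"
  shows "g * f \<in> FA.span (B \<union> I)"
  using assms(1)
proof (induction rule: FA.span_induct_alt)
  case base
  then show ?case by (simp add: FA.span_zero)
next
  case (step c f h)
  have "g * f \<in> FA.span (B \<union> I)"
    using step(1) assms(2) by (auto intro: span_mem mult_mem_left)
  then show ?case
    using step by (simp add: distrib_left FA.span_add FA.span_scale)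
qed

text \<open>
  Spans are taken of \<open>B \<union> I\<close>, so that membership depends only on the class modulo \<open>I\<close>; the part
  of a combination that comes from \<open>I\<close> is then discarded.
\<close>

lemma span_mod_explicit:
  assumes "f \<in> FA.span (B \<union> I)"
  obtains K c where "finite K" "K \<subseteq> B" "\<And>b. b \<in> K \<Longrightarrow> c b \<noteq> 0" "f \<approx> (\<Sum>b\<in>K. scl (c b) b)"
proof -
  from assms obtain c where fin: "finite {b. c b \<noteq> 0}" and sub: "\<And>b. c b \<noteq> 0 \<Longrightarrow> b \<in> B \<union> I"
    and f: "f = (\<Sum>b | c b \<noteq> 0. scl (c b) b)"
    unfolding FA.span_explicit' by blast
  let ?K = "{b. c b \<noteq> 0} \<inter> B"
  let ?L = "{b. c b \<noteq> 0} - B"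
  have "f = (\<Sum>b\<in>?K. scl (c b) b) + (\<Sum>b\<in>?L. scl (c b) b)"
    unfolding f using fin by (rule sum.Int_Diff)
  moreover have "(\<Sum>b\<in>?L. scl (c b) b) \<in> I"
    using sub by (intro sum_mem scl_mem) blast
  ultimately have "f \<approx> (\<Sum>b\<in>?K. scl (c b) b)" by (simp add: eqv_def)
  with fin show thesis by (intro that[of ?K c]) auto
qed

end

section \<open>Consequences of the defining relations\<close>

locale quantum_params =
  fixes p q l m :: "'k::field"
  assumes p0 [simp]: "p \<noteq> 0" and q0 [simp]: "q \<noteq> 0" and l0 [simp]: "l \<noteq> 0" and m0 [simp]: "m \<noteq> 0"
    and p_no_root: "n > 0 \<Longrightarrow> p ^ n \<noteq> 1"
    and q_no_root: "n > 0 \<Longrightarrow> q ^ n \<noteq> 1"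
begin

lemma p1 [simp]: "p \<noteq> 1" "p - 1 \<noteq> 0" "1 - p \<noteq> 0"
  using p_no_root[of 1] by auto

text \<open>
  The quantum integer \<open>1 + p + \<dots> + p\<^sup>n\<^sup>-\<^sup>1\<close>.
\<close>

definition qnum :: "nat \<Rightarrow> 'k" where "qnum n = (p ^ n - 1) / (p - 1)"

lemma qnum_Suc: "qnum (Suc n) = p * qnum n + 1" "qnum (Suc n) = p ^ n + qnum n"
  by (simp_all add: qnum_def divide_simps) (simp_all add: algebra_simps)

lemma qnum_1 [simp]: "qnum (Suc 0) = 1"
  by (simp add: qnum_def)

lemma qnum_nonzero: "n > 0 \<Longrightarrow> qnum n \<noteq> 0"
  using p_no_root by (simp add: qnum_def)

end

abbreviation "gX \<equiv> free_gen X :: gen free_monoid \<Rightarrow>\<^sub>0 'k::field"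
abbreviation "gY \<equiv> free_gen Y :: gen free_monoid \<Rightarrow>\<^sub>0 'k::field"
abbreviation "gS \<equiv> free_gen S :: gen free_monoid \<Rightarrow>\<^sub>0 'k::field"
abbreviation "gT \<equiv> free_gen T :: gen free_monoid \<Rightarrow>\<^sub>0 'k::field"
abbreviation "gZ \<equiv> gX * gY - gY * gX"

lemma relators_eq:
  "relators p q l m =
    {gX * gY - scl p (gY * gX) - 1, gS * gT - scl q (gT * gS),
     gS * gX - scl l (gX * gS), gS * gY - scl (inverse l) (gY * gS),
     gT * gX - scl m (gX * gT), gT * gY - scl (inverse m) (gY * gT)}"
  by (simp add: relators_def Let_def scl_def mult.assoc)

locale relation_ideal = quantum_params p q l m + falg_ideal I
  for p q l m :: "'k::field" and I :: "(gen free_monoid \<Rightarrow>\<^sub>0 'k) set" +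
  assumes relators_sub: "relators p q l m \<subseteq> I"
begin

lemma xy_eqv: "gX * gY \<approx> scl p (gY * gX) + 1"
  using relators_sub by (simp add: eqv_def relators_eq algebra_simps)

lemma quasi_relations:
  "quasi gS gT q" "quasi gS gX l" "quasi gS gY (inverse l)" "quasi gT gX m" "quasi gT gY (inverse m)"
  using relators_sub by (simp_all add: quasi_def eqv_def relators_eq)

lemma gZ_eqv: "gZ \<approx> scl (p - 1) (gY * gX) + 1"
  using eqv_diff[OF xy_eqv eqv_refl[of "gY * gX"]]
  by (simp add: FA.scale_left_diff_distrib algebra_simps)

lemma yx_eqv: "gY * gX \<approx> scl (1 / (p - 1)) (gZ - 1)"
proof -
  have "scl (1 / (p - 1)) (gZ - 1) \<approx> scl (1 / (p - 1)) (scl (p - 1) (gY * gX) + 1 - 1)"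
    by (intro eqv_scl eqv_diff gZ_eqv eqv_refl)
  then show ?thesis by (simp add: eqv_sym)
qed

lemma quasi_X_Z: "quasi gX gZ p"
proof -
  \<comment> \<open>With the defining relator \<open>R\<close>, one has \<open>x R - R x = x z - p z x\<close> in the free algebra.\<close>
  let ?R = "gX * gY - scl p (gY * gX) - 1"
  have "?R \<in> I" using relators_sub by (simp add: relators_eq)
  from diff_mem[OF mult_mem_left[OF this] mult_mem_right[OF this]]
  have "gX * ?R - ?R * gX \<in> I" .
  also have "gX * ?R - ?R * gX = gX * gZ - scl p (gZ * gX)"
    by (simp add: algebra_simps FA.scale_right_diff_distrib)
  finally show ?thesis by (simp add: quasi_def eqv_def)
qed

lemma quasi_Z_Y: "quasi gZ gY p"
proof -
  \<comment> \<open>Likewise \<open>R y - y R = z y - p y z\<close>.\<close>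
  let ?R = "gX * gY - scl p (gY * gX) - 1"
  have "?R \<in> I" using relators_sub by (simp add: relators_eq)
  from diff_mem[OF mult_mem_right[OF this] mult_mem_left[OF this]]
  have "?R * gY - gY * ?R \<in> I" .
  also have "?R * gY - gY * ?R = gZ * gY - scl p (gY * gZ)"
    by (simp add: algebra_simps FA.scale_right_diff_distrib)
  finally show ?thesis by (simp add: quasi_def eqv_def)
qed

lemma quasi_S_Z: "quasi gS gZ 1"
  using quasi_mult[OF quasi_relations(2,3)] quasi_mult[OF quasi_relations(3,2)]
  by (intro quasi_diff) simp_all

lemma quasi_T_Z: "quasi gT gZ 1"
  using quasi_mult[OF quasi_relations(4,5)] quasi_mult[OF quasi_relations(5,4)]
  by (intro quasi_diff) simp_all

lemmas quasi_table =
  quasi_relations quasi_X_Z quasi_Z_Y quasi_S_Z quasi_T_Z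
  quasi_relations[THEN quasi_sym, simplified]
  quasi_X_Z[THEN quasi_sym, simplified] quasi_Z_Y[THEN quasi_sym, simplified]
  quasi_S_Z[THEN quasi_sym, simplified] quasi_T_Z[THEN quasi_sym, simplified]
  quasi_self

lemma x_ypow: "gX * gY ^ Suc n \<approx> scl (p ^ Suc n) (gY ^ Suc n * gX) + scl (qnum (Suc n)) (gY ^ n)"
proof (induction n)
  case 0
  then show ?case using xy_eqv by simp
next
  case (Suc n)
  have "gX * gY ^ Suc (Suc n) = (gX * gY) * gY ^ Suc n"
    by (simp add: mult.assoc)
  also have "\<dots> \<approx> (scl p (gY * gX) + 1) * gY ^ Suc n"
    by (rule eqv_mult_right[OF xy_eqv])
  also have "\<dots> = scl p (gY * (gX * gY ^ Suc n)) + gY ^ Suc n"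
    by (simp add: distrib_right mult.assoc)
  also have "\<dots> \<approx> scl p (gY * (scl (p ^ Suc n) (gY ^ Suc n * gX) + scl (qnum (Suc n)) (gY ^ n))) + gY ^ Suc n"
    by (intro eqv_add eqv_scl eqv_mult_left Suc eqv_refl)
  also have "\<dots> = scl (p ^ Suc (Suc n)) (gY ^ Suc (Suc n) * gX) + scl (qnum (Suc (Suc n))) (gY ^ Suc n)"
    by (simp add: qnum_Suc(1)[of "Suc n"] distrib_left FA.scale_right_distrib FA.scale_left_distrib mult.assoc)
  finally show ?case .
qed

lemma xpow_y: "gX ^ Suc n * gY \<approx> scl (p ^ Suc n) (gY * gX ^ Suc n) + scl (qnum (Suc n)) (gX ^ n)"
proof (induction n)
  case 0
  then show ?case using xy_eqv by simp
next
  case (Suc n)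
  have "gX ^ Suc (Suc n) * gY = gX * (gX ^ Suc n * gY)"
    by (simp add: mult.assoc)
  also have "\<dots> \<approx> gX * (scl (p ^ Suc n) (gY * gX ^ Suc n) + scl (qnum (Suc n)) (gX ^ n))"
    by (rule eqv_mult_left[OF Suc])
  also have "\<dots> = scl (p ^ Suc n) ((gX * gY) * gX ^ Suc n) + scl (qnum (Suc n)) (gX ^ Suc n)"
    by (simp add: distrib_left mult.assoc)
  also have "\<dots> \<approx> scl (p ^ Suc n) ((scl p (gY * gX) + 1) * gX ^ Suc n) + scl (qnum (Suc n)) (gX ^ Suc n)"
    by (intro eqv_add eqv_scl eqv_mult_right xy_eqv eqv_refl)
  also have "\<dots> = scl (p ^ Suc (Suc n)) (gY * gX ^ Suc (Suc n)) + scl (qnum (Suc (Suc n))) (gX ^ Suc n)"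
    by (simp add: qnum_Suc(2)[of "Suc n"] distrib_right FA.scale_right_distrib FA.scale_left_distrib
        mult_ac)
  finally show ?case .
qed

subsection \<open>A spanning set of normal words\<close>

definition word :: "nat \<Rightarrow> nat \<Rightarrow> nat \<Rightarrow> nat \<Rightarrow> gen free_monoid \<Rightarrow>\<^sub>0 'k" where
  "word i j k n = gY ^ i * gX ^ j * gS ^ k * gT ^ n"

text \<open>
  The span of the normal words contains \<open>1\<close> and is stable under left multiplication by the four
  generators: only \<open>x\<close> needs more than a scalar, and there \<open>x_ypow\<close> moves it past the power of \<open>y\<close>.
\<close>

lemma span_words: "f \<in> FA.span (range (\<lambda>(i, j, k, n). word i j k n) \<union> I)"
proof (induction f rule: free_algebra_induct)
  case one
  have "1 = (\<lambda>(i, j, k, n). word i j k n) (0, 0, 0, 0)" by (simp add: word_def)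
  then show ?case by (intro FA.span_base UnI1) (rule range_eqI)
next
  case (gen g f)
  let ?V = "FA.span (range (\<lambda>(i, j, k, n). word i j k n) \<union> I)"
  have w: "scl c (word i j k n) \<in> ?V" for c i j k n
    by (intro FA.span_scale FA.span_base UnI1 range_eqI[of _ _ "(i, j, k, n)"]) simp
  have "free_gen g * word i j k n \<in> ?V" for i j k n
  proof (cases g)
    case X
    show ?thesis
    proof (cases i)
      case 0
      then have "gX * word i j k n = scl 1 (word 0 (Suc j) k n)"
        by (simp add: word_def mult.assoc)
      then show ?thesis using w X by metis
    next
      case (Suc i')
      have "gX * word i j k n = (gX * gY ^ Suc i') * (gX ^ j * gS ^ k * gT ^ n)"
        by (simp add: word_def Suc mult.assoc)
      also have "\<dots> \<approx> (scl (p ^ Suc i') (gY ^ Suc i' * gX) + scl (qnum (Suc i')) (gY ^ i'))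
          * (gX ^ j * gS ^ k * gT ^ n)"
        by (rule eqv_mult_right[OF x_ypow])
      also have "\<dots> = scl (p ^ Suc i') (word (Suc i') (Suc j) k n) + scl (qnum (Suc i')) (word i' j k n)"
        by (simp add: word_def distrib_right mult.assoc)
      finally show ?thesis unfolding X by (rule span_eqv) (intro FA.span_add w)
    qed
  next
    case Y
    have "gY * word i j k n = scl 1 (word (Suc i) j k n)" by (simp add: word_def mult.assoc)
    then show ?thesis using w Y by metis
  next
    case S
    have "quasi gS (gY ^ i * gX ^ j) (inverse l ^ i * l ^ j)"
      by (intro quasi_mult quasi_power quasi_table)
    then have "gS * (gY ^ i * gX ^ j) * (gS ^ k * gT ^ n)
        \<approx> scl (inverse l ^ i * l ^ j) (gY ^ i * gX ^ j * gS) * (gS ^ k * gT ^ n)"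
      unfolding quasi_def by (rule eqv_mult_right)
    then have "gS * word i j k n \<approx> scl (inverse l ^ i * l ^ j) (word i j (Suc k) n)"
      by (simp add: word_def mult.assoc)
    then show ?thesis unfolding S by (rule span_eqv) (rule w)
  next
    case T
    have "quasi gT (gY ^ i * gX ^ j * gS ^ k) (inverse m ^ i * m ^ j * inverse q ^ k)"
      by (intro quasi_mult quasi_power quasi_table)
    then have "gT * (gY ^ i * gX ^ j * gS ^ k) * gT ^ n
        \<approx> scl (inverse m ^ i * m ^ j * inverse q ^ k) (gY ^ i * gX ^ j * gS ^ k * gT) * gT ^ n"
      unfolding quasi_def by (rule eqv_mult_right)
    then have "gT * word i j k n \<approx> scl (inverse m ^ i * m ^ j * inverse q ^ k) (word i j k (Suc n))"
      by (simp add: word_def mult.assoc)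
    then show ?thesis unfolding T by (rule span_eqv) (rule w)
  qed
  with gen show ?case by (auto intro: span_mult_left)
qed (auto intro: FA.span_add FA.span_scale)

text \<open>
  Words in which a killed generator occurs vanish. If \<open>z\<close> is killed, then \<open>y x\<close> is the nonzero
  scalar \<open>-1 / (p - 1)\<close>, so \<open>x\<close> and \<open>y\<close> cancel in pairs and only pure powers of one of them remain.
\<close>

lemma span_reduced_words:
  assumes z: "\<zeta> = 0 \<Longrightarrow> gZ \<in> I" and s: "\<sigma> = 0 \<Longrightarrow> gS \<in> I" and t: "\<tau> = 0 \<Longrightarrow> gT \<in> I"
  shows "f \<in> FA.span ({word i j k n | i j k n.
      (\<zeta> = 0 \<longrightarrow> i = 0 \<or> j = 0) \<and> (\<sigma> = 0 \<longrightarrow> k = 0) \<and> (\<tau> = 0 \<longrightarrow> n = 0)} \<union> I)"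
    (is "f \<in> FA.span (?W \<union> I)")
proof -
  have "word i j k n \<in> FA.span (?W \<union> I)" for i j k n
  proof (cases "(\<sigma> = 0 \<and> k \<noteq> 0) \<or> (\<tau> = 0 \<and> n \<noteq> 0)")
    case True
    then have "gS ^ k * gT ^ n \<in> I"
    proof (elim disjE conjE)
      assume "\<sigma> = 0" "k \<noteq> 0"
      then obtain k' where "k = Suc k'" by (cases k) auto
      then show ?thesis
        using mult_mem_right[OF s[OF \<open>\<sigma> = 0\<close>], of "gS ^ k' * gT ^ n"] by (simp add: mult.assoc)
    next
      assume "\<tau> = 0" "n \<noteq> 0"
      then obtain n' where "n = Suc n'" by (cases n) auto
      then show ?thesis
        using mult_mem_left[OF t[OF \<open>\<tau> = 0\<close>], of "gS ^ k * gT ^ n'"]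
        by (simp add: mult.assoc power_commutes)
    qed
    then have "word i j k n \<in> I"
      using mult_mem_left[of "gS ^ k * gT ^ n" "gY ^ i * gX ^ j"] by (simp add: word_def mult.assoc)
    then show ?thesis by (rule span_mem)
  next
    case False
    show ?thesis
    proof (induction i arbitrary: j)
      case 0
      then show ?case using False by (intro FA.span_base) auto
    next
      case (Suc i)
      show ?case
      proof (cases "\<zeta> = 0 \<and> j \<noteq> 0")
        case False
        have "word (Suc i) j k n \<in> ?W"
          by (intro CollectI exI[of _ "Suc i"] exI[of _ j] exI[of _ k] exI[of _ n])
            (use False \<open>\<not> (\<sigma> = 0 \<and> k \<noteq> 0 \<or> _)\<close> in auto)
        then show ?thesis by (intro FA.span_base) simp
      next
        case True
        then obtain j' where j: "j = Suc j'" by (cases j) auto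
        have "gZ \<approx> 0" using True z by (simp add: eqv_zero_iff)
        have "gY * gX \<approx> scl (1 / (p - 1)) (gZ - 1)" by (rule yx_eqv)
        also have "\<dots> \<approx> scl (1 / (p - 1)) (0 - 1)"
          by (intro eqv_scl eqv_diff \<open>gZ \<approx> 0\<close> eqv_refl)
        finally have "gY ^ i * (gY * gX) * (gX ^ j' * gS ^ k * gT ^ n)
            \<approx> gY ^ i * scl (1 / (p - 1)) (0 - 1) * (gX ^ j' * gS ^ k * gT ^ n)"
          by (intro eqv_mult_right eqv_mult_left)
        also have "\<dots> = scl (- (1 / (p - 1))) (word i j' k n)"
          by (simp add: word_def mult.assoc FA.scale_minus_left[symmetric] del: FA.scale_minus_left)
        finally have "word (Suc i) j k n \<approx> scl (- (1 / (p - 1))) (word i j' k n)"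
          by (simp add: word_def j mult.assoc power_Suc2[of gY] power_Suc[of gX] del: power_Suc)
        then show ?thesis
          by (rule span_eqv) (intro FA.span_scale Suc.IH)
      qed
    qed
  qed
  then have "range (\<lambda>(i, j, k, n). word i j k n) \<union> I \<subseteq> FA.span (?W \<union> I)"
    using span_mem by auto
  then have "FA.span (range (\<lambda>(i, j, k, n). word i j k n) \<union> I) \<subseteq> FA.span (?W \<union> I)"
    by (rule FA.span_minimal) (rule FA.subspace_span)
  then show ?thesis using span_words by blast
qed

end

section \<open>A triangular representation\<close>

text \<open>
  Exponents \<open>(b, a, k, n)\<close> stand for \<open>z\<^sup>b x\<^sup>a s\<^sup>k t\<^sup>n\<close>. The lexicographic order looks at the power of \<open>z\<close>
  first, so that in \<open>y = (z - 1) x\<^sup>-\<^sup>1 / (p - 1)\<close> the term with \<open>z\<close> leads.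
\<close>

type_synonym 'k lattice_vec = "int \<times> int \<times> int \<times> int \<Rightarrow> 'k"

definition has_lead :: "'k::field lattice_vec \<Rightarrow> int \<times> int \<times> int \<times> int \<Rightarrow> bool" where
  "has_lead v e \<longleftrightarrow> v e \<noteq> 0 \<and> (\<forall>e'>e. v e' = 0)"

text \<open>
  The vector \<open>d\<close> plays the role of the degree of an operator. Such an operator sends
  vectors that have a leading exponent to nonzero vectors, and degrees add up under composition.
\<close>

definition shifts_lead :: "('k::field lattice_vec \<Rightarrow> 'k lattice_vec) \<Rightarrow> int \<times> int \<times> int \<times> int \<Rightarrow> bool" where
  "shifts_lead F d \<longleftrightarrow> (\<forall>v e. has_lead v e \<longrightarrow> has_lead (F v) (d + e))"

lemma lex_add_left_mono:
  fixes d e e' :: "int \<times> int \<times> int \<times> int"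
  shows "d + e < d + e' \<longleftrightarrow> e < e'"
  by (cases d; cases e; cases e') auto

lemma shifts_lead_id: "shifts_lead (\<lambda>v. v) 0"
  by (simp add: shifts_lead_def)

lemma shifts_lead_comp:
  "shifts_lead F d \<Longrightarrow> shifts_lead G d' \<Longrightarrow> shifts_lead (\<lambda>v. F (G v)) (d + d')"
  unfolding shifts_lead_def by (metis add.assoc)

lemma shifts_lead_monomial:
  fixes F :: "'a::field lattice_vec \<Rightarrow> 'a lattice_vec"
  assumes "\<And>v e. F v (d + e) = c e * v e" and "\<And>e. c e \<noteq> 0"
  shows "shifts_lead F d"
  unfolding shifts_lead_def has_lead_def
proof (intro allI impI conjI)
  fix v :: "'a lattice_vec" and e e' assume v: "v e \<noteq> 0 \<and> (\<forall>e'>e. v e' = 0)"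
  show "F v (d + e) \<noteq> 0" using v assms by simp
  assume "d + e < e'"
  then have "e < e' - d" using lex_add_left_mono[of d e "e' - d"] by simp
  then show "F v e' = 0" using assms(1)[of v "e' - d"] v by simp
qed

text \<open>
  With pairwise distinct degrees no cancellation of leading terms can occur: the summand with the
  largest degree decides.
\<close>

lemma shifts_lead_sum:
  fixes F :: "'i \<Rightarrow> 'a::field lattice_vec \<Rightarrow> 'a lattice_vec"
  assumes fin: "finite K" and ne: "K \<noteq> {}" and c: "\<And>i. i \<in> K \<Longrightarrow> c i \<noteq> 0"
    and F: "\<And>i. i \<in> K \<Longrightarrow> shifts_lead (F i) (d i)" and inj: "inj_on d K"
  obtains d' where "shifts_lead (\<lambda>v e. \<Sum>i\<in>K. c i * F i v e) d'"
proof
  let ?D = "Max (d ` K)"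
  have "?D \<in> d ` K" using fin ne by simp
  then obtain k where k: "k \<in> K" "d k = ?D" by auto
  show "shifts_lead (\<lambda>v e. \<Sum>i\<in>K. c i * F i v e) ?D"
    unfolding shifts_lead_def
  proof (intro allI impI)
    fix v :: "'a lattice_vec" and e assume v: "has_lead v e"
    have lead: "has_lead (F i v) (d i + e)" if "i \<in> K" for i
      using F[OF that] v unfolding shifts_lead_def by blast
    have le: "d i + e \<le> ?D + e" if "i \<in> K" for i
    proof -
      have "d i \<le> ?D" using fin that by simp
      then show ?thesis using lex_add_left_mono[of e ?D "d i"] by (simp add: add.commute flip: not_less)
    qed
    have "(\<Sum>i\<in>K. c i * F i v (?D + e)) = (\<Sum>i\<in>{k}. c i * F i v (?D + e))"
    proof (rule sum.mono_neutral_right)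
      show "\<forall>i\<in>K - {k}. c i * F i v (?D + e) = 0"
      proof
        fix i assume i: "i \<in> K - {k}"
        then have "d i \<noteq> ?D" using inj k by (metis DiffD1 DiffD2 inj_on_def singletonI)
        then have "d i + e < ?D + e" using le[of i] i by (simp add: order_less_le)
        then have "F i v (?D + e) = 0" using lead[of i] i unfolding has_lead_def by blast
        then show "c i * F i v (?D + e) = 0" by simp
      qed
    qed (use k fin in auto)
    also have "\<dots> \<noteq> 0" using lead[OF k(1)] c[OF k(1)] k(2) by (simp add: has_lead_def)
    finally have "(\<Sum>i\<in>K. c i * F i v (?D + e)) \<noteq> 0" .
    moreover have "(\<Sum>i\<in>K. c i * F i v e') = 0" if e': "?D + e < e'" for e'
    proof (rule sum.neutral, rule ballI)
      fix i assume i: "i \<in> K"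
      have "d i + e < e'" using order_le_less_trans[OF le[OF i] e'] .
      then have "F i v e' = 0" using lead[OF i] unfolding has_lead_def by blast
      then show "c i * F i v e' = 0" by simp
    qed
    ultimately show "has_lead (\<lambda>e. \<Sum>i\<in>K. c i * F i v e) (?D + e)"
      by (simp add: has_lead_def)
  qed
qed

text \<open>
  The parameters are the factors by which \<open>z\<close>, \<open>s\<close>, \<open>t\<close> act; zero means that the generator is killed.
\<close>

locale quotient_model = quantum_params p q l m
  for p q l m :: "'k::field" +
  fixes \<zeta> \<sigma> \<tau> :: 'k
begin

text \<open>
  This is left multiplication on the quantum torus with basis \<open>z\<^sup>b x\<^sup>a s\<^sup>k t\<^sup>n\<close>, written on coefficient
  functions: for instance \<open>x z\<^sup>b x\<^sup>a = p\<^sup>b z\<^sup>b x\<^sup>a\<^sup>+\<^sup>1\<close> and, with \<open>z\<close> replaced by \<open>\<zeta> z\<close>,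
  \<open>y z\<^sup>b x\<^sup>a = p\<^sup>-\<^sup>b (\<zeta> z\<^sup>b\<^sup>+\<^sup>1 - z\<^sup>b) x\<^sup>a\<^sup>-\<^sup>1 / (p - 1)\<close>. All functions are admitted, not only those with
  finite support, since each coefficient of the result depends on finitely many coefficients.
\<close>

fun act :: "gen \<Rightarrow> 'k lattice_vec \<Rightarrow> 'k lattice_vec" where
  "act X v = (\<lambda>(b, a, k, n). p powi b * v (b, a - 1, k, n))"
| "act Y v = (\<lambda>(b, a, k, n).
      (\<zeta> * p powi (1 - b) * v (b - 1, a + 1, k, n) - p powi (- b) * v (b, a + 1, k, n)) / (p - 1))"
| "act S v = (\<lambda>(b, a, k, n). \<sigma> * l powi a * v (b, a, k - 1, n))"
| "act T v = (\<lambda>(b, a, k, n). \<tau> * m powi a * q powi (- k) * v (b, a, k, n - 1))"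

definition rep :: "(gen free_monoid \<Rightarrow>\<^sub>0 'k) \<Rightarrow> 'k lattice_vec \<Rightarrow> 'k lattice_vec" where
  "rep f v = (\<lambda>e. \<Sum>w\<in>Poly_Mapping.keys f. Poly_Mapping.lookup f w * foldr act (letters w) v e)"

lemma rep_superset:
  assumes "finite A" "Poly_Mapping.keys f \<subseteq> A"
  shows "rep f v e = (\<Sum>w\<in>A. Poly_Mapping.lookup f w * foldr act (letters w) v e)"
  unfolding rep_def by (rule sum.mono_neutral_left) (use assms in \<open>auto simp: in_keys_iff\<close>)

lemma rep_single: "rep (Poly_Mapping.single w c) v e = c * foldr act (letters w) v e"
  by (simp add: rep_superset[of "{w}"])

lemma rep_add: "rep (f + g) v e = rep f v e + rep g v e"
  by (simp add: rep_superset[of "Poly_Mapping.keys f \<union> Poly_Mapping.keys g"] Poly_Mapping.keys_add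
      lookup_add distrib_right sum.distrib)

lemma rep_scl: "rep (scl c f) v e = c * rep f v e"
proof (induction f rule: poly_mapping_single_induct)
  case (single w d)
  then show ?case by (simp add: scl_def free_const_def mult_single rep_single)
qed (simp add: FA.scale_right_distrib rep_add distrib_left)

lemma rep_zero [simp]: "rep 0 v e = 0"
  by (simp add: rep_def)

lemma rep_diff: "rep (f - g) v e = rep f v e - rep g v e"
  using rep_add[of "f - g" g v e] by simp

lemma rep_sum: "rep (sum h A) v e = (\<Sum>i\<in>A. rep (h i) v e)"
  by (induction A rule: infinite_finite_induct) (simp_all add: rep_add)

lemma act_add: "act g (\<lambda>e. u e + v e) = (\<lambda>e. act g u e + act g v e)"
  by (cases g) (auto simp: fun_eq_iff algebra_simps add_divide_distrib diff_divide_distrib)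

lemma act_cmult: "act g (\<lambda>e. c * u e) = (\<lambda>e. c * act g u e)"
  by (cases g) (auto simp: fun_eq_iff algebra_simps add_divide_distrib diff_divide_distrib)

lemma foldr_act_add: "foldr act ws (\<lambda>e. u e + v e) = (\<lambda>e. foldr act ws u e + foldr act ws v e)"
  by (induction ws) (simp_all add: act_add del: act.simps)

lemma foldr_act_cmult: "foldr act ws (\<lambda>e. c * u e) = (\<lambda>e. c * foldr act ws u e)"
  by (induction ws) (simp_all add: act_cmult del: act.simps)

lemma rep_add_vec: "rep f (\<lambda>e. u e + v e) = (\<lambda>e. rep f u e + rep f v e)"
  by (simp add: rep_def foldr_act_add distrib_left sum.distrib)

lemma rep_cmult_vec: "rep f (\<lambda>e. c * u e) = (\<lambda>e. c * rep f u e)"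
  by (simp add: rep_def foldr_act_cmult sum_distrib_left mult_ac)

lemma rep_mult: "rep (f * g) v = rep f (rep g v)"
proof (induction f rule: poly_mapping_single_induct)
  case (single w c)
  show ?case
  proof (induction g rule: poly_mapping_single_induct)
    case (single w' d)
    show ?case
      by (simp add: mult_single fun_eq_iff rep_single plus_free_monoid_def foldr_act_cmult)
  next
    case (add g g')
    then show ?case by (simp add: fun_eq_iff distrib_left rep_add rep_add_vec)
  qed
next
  case (add f f')
  then show ?case by (simp add: fun_eq_iff distrib_right rep_add)
qed

lemma rep_one [simp]: "rep 1 = (\<lambda>v. v)"
proof (intro ext)
  fix v e
  have "rep (Poly_Mapping.single 0 1) v e = v e"
    by (subst rep_single) (simp add: zero_free_monoid_def)
  then show "rep 1 v e = v e" by simp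
qed

lemma rep_gen: "rep (free_gen g) v = act g v"
  by (simp add: free_gen_def fun_eq_iff rep_single)

lemma powi_shift:
  "p powi (1 - b) = p * p powi (- b)" "p powi (b - 1) = p powi b / p"
  "p powi b * (p powi (- b) * c) = c" "p powi (- b) * (p powi b * c) = c"
  using power_int_add[of p 1 "- b"] power_int_add[of p b "-b"]
  by (simp_all add: power_int_diff power_int_minus)

lemma rep_gY_gX:
  "rep (gY * gX) v (b, a, k, n) = (\<zeta> * v (b - 1, a, k, n) - v (b, a, k, n)) / (p - 1)"
  by (simp add: rep_mult rep_gen powi_shift mult_ac)

lemma rep_gX_gY:
  "rep (gX * gY) v (b, a, k, n) = (\<zeta> * p * v (b - 1, a, k, n) - v (b, a, k, n)) / (p - 1)"
  by (simp add: rep_mult rep_gen powi_shift right_diff_distrib mult_ac)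

lemma rep_gZ: "rep gZ v (b, a, k, n) = \<zeta> * v (b - 1, a, k, n)"
proof -
  have "rep gZ v (b, a, k, n) = \<zeta> * v (b - 1, a, k, n) * (p - 1) / (p - 1)"
    by (simp only: rep_diff rep_gX_gY rep_gY_gX diff_divide_distrib[symmetric]) (simp add: algebra_simps)
  then show ?thesis by simp
qed

definition J :: "(gen free_monoid \<Rightarrow>\<^sub>0 'k) set" where
  "J = Idl\<^bsub>free_algebra\<^esub> (relators p q l m \<union> (if \<zeta> = 0 then {gZ} else {})
      \<union> (if \<sigma> = 0 then {gS} else {}) \<union> (if \<tau> = 0 then {gT} else {}))"

lemma J_gens: "relators p q l m \<subseteq> J" "\<zeta> = 0 \<Longrightarrow> gZ \<in> J" "\<sigma> = 0 \<Longrightarrow> gS \<in> J" "\<tau> = 0 \<Longrightarrow> gT \<in> J"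
proof -
  let ?G = "relators p q l m \<union> (if \<zeta> = 0 then {gZ} else {})
      \<union> (if \<sigma> = 0 then {gS} else {}) \<union> (if \<tau> = 0 then {gT} else {})"
  have "?G \<subseteq> J"
    unfolding J_def by (rule ring.genideal_self[OF ring_free_algebra]) (simp add: free_algebra_def)
  then show "relators p q l m \<subseteq> J" "\<zeta> = 0 \<Longrightarrow> gZ \<in> J" "\<sigma> = 0 \<Longrightarrow> gS \<in> J" "\<tau> = 0 \<Longrightarrow> gT \<in> J"
    by (auto split: if_splits)
qed

lemma J_ideal: "ideal J free_algebra"
  unfolding J_def by (rule ring.genideal_ideal[OF ring_free_algebra]) (simp add: free_algebra_def)

lemma J_minimal:
  assumes "ideal H free_algebra" "relators p q l m \<subseteq> H"
    and "\<zeta> = 0 \<Longrightarrow> gZ \<in> H" "\<sigma> = 0 \<Longrightarrow> gS \<in> H" "\<tau> = 0 \<Longrightarrow> gT \<in> H"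
  shows "J \<subseteq> H"
  unfolding J_def by (rule ring.genideal_minimal[OF ring_free_algebra]) (use assms in auto)

sublocale relation_ideal p q l m J
  by (intro relation_ideal.intro quantum_params_axioms falg_ideal.intro
      relation_ideal_axioms.intro J_ideal J_gens(1))

lemma rep_relators:
  assumes "f \<in> relators p q l m"
  shows "rep f v e = 0"
proof -
  obtain b a k n where e: "e = (b, a, k, n)" by (cases e)
  have XY: "rep (gX * gY - scl p (gY * gX) - 1) v e = 0"
  proof -
    let ?u = "v (b - 1, a, k, n)" and ?w = "v (b, a, k, n)"
    have "rep (gX * gY - scl p (gY * gX) - 1) v e
        = ((\<zeta> * p * ?u - ?w) - p * (\<zeta> * ?u - ?w)) / (p - 1) - ?w"
      by (simp only: rep_diff rep_scl rep_one rep_gX_gY rep_gY_gX e)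
        (simp add: diff_divide_distrib right_diff_distrib)
    also have "(\<zeta> * p * ?u - ?w) - p * (\<zeta> * ?u - ?w) = ?w * (p - 1)"
      by (simp add: algebra_simps)
    finally show ?thesis by simp
  qed
  have powi_pred: "c powi (d - 1) = c powi d / c" "c powi (d + 1) = c powi d * c"
      "c powi (1 - d) = c / c powi d"
    if "c \<noteq> 0" for c :: 'k and d
    using that by (simp_all add: power_int_diff power_int_add)
  have "rep (gS * gT - scl q (gT * gS)) v e = 0"
    by (simp add: e rep_diff rep_scl rep_mult rep_gen powi_pred power_int_minus field_simps)
  moreover have "rep (gS * gX - scl l (gX * gS)) v e = 0"
    by (simp add: e rep_diff rep_scl rep_mult rep_gen powi_pred)
  moreover have "rep (gS * gY - scl (inverse l) (gY * gS)) v e = 0"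
    by (simp add: e rep_diff rep_scl rep_mult rep_gen powi_pred field_simps)
  moreover have "rep (gT * gX - scl m (gX * gT)) v e = 0"
    by (simp add: e rep_diff rep_scl rep_mult rep_gen powi_pred)
  moreover have "rep (gT * gY - scl (inverse m) (gY * gT)) v e = 0"
    by (simp add: e rep_diff rep_scl rep_mult rep_gen powi_pred field_simps)
  ultimately show ?thesis
    using assms XY by (auto simp only: relators_eq insert_iff empty_iff)
qed

lemma kernel_ideal: "ideal {f. \<forall>v e. rep f v e = 0} free_algebra"
proof (rule idealI)
  let ?N = "{f. \<forall>v e. rep f v e = 0}"
  show "ring (free_algebra :: (gen free_monoid \<Rightarrow>\<^sub>0 'k) ring)" by (rule ring_free_algebra)
  have rep_const_zero: "rep f (\<lambda>e. 0) = (\<lambda>e. 0)" for f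
    using rep_cmult_vec[of f 0 "\<lambda>e. 0"] by simp
  have inv: "inv\<^bsub>add_monoid free_algebra\<^esub> f = - f" for f :: "gen free_monoid \<Rightarrow>\<^sub>0 'k"
    using abelian_group.minus_equality[OF ring.is_abelian_group[OF ring_free_algebra], of "- f" f]
    by (simp add: free_algebra_def a_inv_def)
  have rep_uminus: "rep (- f) v e = - rep f v e" for f v e
    using rep_diff[of 0 f v e] by simp
  show "subgroup ?N (add_monoid free_algebra)"
  proof (rule subgroup.intro)
    show "inv\<^bsub>add_monoid free_algebra\<^esub> f \<in> ?N" if "f \<in> ?N" for f
      using that unfolding inv by (simp add: rep_uminus)
  qed (auto simp: free_algebra_def rep_add)
  show "g \<otimes>\<^bsub>free_algebra\<^esub> f \<in> ?N" if "f \<in> ?N" for f g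
  proof -
    have "rep f v = (\<lambda>e. 0)" for v using that by auto
    then show ?thesis by (simp add: free_algebra_def rep_mult rep_const_zero)
  qed
  show "f \<otimes>\<^bsub>free_algebra\<^esub> g \<in> ?N" if "f \<in> ?N" for f g
    using that by (simp add: free_algebra_def rep_mult)
qed

text \<open>
  The action factors through the quotient by \<open>J\<close>, because its kernel is an ideal that contains the
  generators of \<open>J\<close>.
\<close>

lemma rep_J: "f \<in> J \<Longrightarrow> rep f v e = 0"
proof -
  have "J \<subseteq> {f. \<forall>v e. rep f v e = 0}"
  proof (rule J_minimal[OF kernel_ideal])
    have "rep gZ v e = 0" if "\<zeta> = 0" for v e
    proof -
      have "\<zeta> * c = 0" for c using that by simp
      then show ?thesis by (cases e) (simp add: rep_gZ)
    qed
    then show "gZ \<in> {f. \<forall>v e. rep f v e = 0}" if "\<zeta> = 0" using that by blast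
    have "rep gS v e = 0" if "\<sigma> = 0" for v e
    proof -
      have "\<sigma> * c = 0" for c using that by simp
      then show ?thesis by (cases e) (simp add: rep_gen mult.assoc)
    qed
    then show "gS \<in> {f. \<forall>v e. rep f v e = 0}" if "\<sigma> = 0" using that by blast
    have "rep gT v e = 0" if "\<tau> = 0" for v e
    proof -
      have "\<tau> * c = 0" for c using that by simp
      then show ?thesis by (cases e) (simp add: rep_gen mult.assoc)
    qed
    then show "gT \<in> {f. \<forall>v e. rep f v e = 0}" if "\<tau> = 0" using that by blast
  qed (simp_all add: rep_relators subset_iff)
  then show "f \<in> J \<Longrightarrow> rep f v e = 0" by blast
qed

text \<open>
  The degree of the normal word \<open>y\<^sup>i x\<^sup>j s\<^sup>k t\<^sup>n\<close>. Since \<open>y\<close> has leading term \<open>z x\<^sup>-\<^sup>1\<close> or, if \<open>z\<close> is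
  killed, \<open>x\<^sup>-\<^sup>1\<close>, the word determines its degree and, among reduced words, is determined by it.
\<close>

definition word_shift :: "nat \<Rightarrow> nat \<Rightarrow> nat \<Rightarrow> nat \<Rightarrow> int \<times> int \<times> int \<times> int" where
  "word_shift i j k n = (if \<zeta> = 0 then 0 else int i, int j - int i, int k, int n)"

lemma shifts_lead_power:
  assumes "shifts_lead (rep f) (a, b, c, d)"
  shows "shifts_lead (rep (f ^ n)) (int n * a, int n * b, int n * c, int n * d)"
proof (induction n)
  case 0
  then show ?case using shifts_lead_id by (simp add: zero_prod_def)
next
  case (Suc n)
  show ?case using shifts_lead_comp[OF assms Suc] by (simp add: rep_mult[abs_def] algebra_simps)
qed

lemma shifts_lead_X: "shifts_lead (rep gX) (0, 1, 0, 0)"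
  by (rule shifts_lead_monomial[where c = "\<lambda>(b, a, k, n). p powi b"]) (auto simp: rep_gen)

lemma shifts_lead_S: "\<sigma> \<noteq> 0 \<Longrightarrow> shifts_lead (rep gS) (0, 0, 1, 0)"
  by (rule shifts_lead_monomial[where c = "\<lambda>(b, a, k, n). \<sigma> * l powi a"]) (auto simp: rep_gen)

lemma shifts_lead_T: "\<tau> \<noteq> 0 \<Longrightarrow> shifts_lead (rep gT) (0, 0, 0, 1)"
  by (rule shifts_lead_monomial[where c = "\<lambda>(b, a, k, n). \<tau> * m powi a * q powi (- k)"])
    (auto simp: rep_gen)

lemma shifts_lead_Z: "\<zeta> \<noteq> 0 \<Longrightarrow> shifts_lead (rep gZ) (1, 0, 0, 0)"
  by (rule shifts_lead_monomial[where c = "\<lambda>_. \<zeta>"]) (auto simp: rep_gZ)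

lemma shifts_lead_Y: "shifts_lead (rep gY) (if \<zeta> = 0 then 0 else 1, - 1, 0, 0)"
proof (cases "\<zeta> = 0")
  case True
  then have \<zeta>0: "\<zeta> * c = 0" for c by simp
  have "shifts_lead (rep gY) (0, - 1, 0, 0)"
    by (intro shifts_lead_monomial[where c = "\<lambda>(b, a, k, n). - (p powi (- b)) / (p - 1)"])
      (auto simp: rep_gen \<zeta>0)
  then show ?thesis by (subst if_P[OF True])
next
  case False
  \<comment> \<open>The term with \<open>z\<close> raises \<open>b\<close>, the other one does not, so the latter cannot reach the lead.\<close>
  have "has_lead (act Y v) (1 + b, a - 1, k, n)" if v: "has_lead v (b, a, k, n)" for v b a k n
  proof -
    have "v (b + 1, a, k, n) = 0" using v by (simp add: has_lead_def)
    moreover have "v (b' - 1, a' + 1, k', n') = 0 \<and> v (b', a' + 1, k', n') = 0"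
      if "(b + 1, a - 1, k, n) < (b', a', k', n')" for b' a' k' n'
    proof -
      have "(b, a, k, n) < (b' - 1, a' + 1, k', n')" "(b, a, k, n) < (b', a' + 1, k', n')"
        using that by auto
      then show ?thesis using v unfolding has_lead_def by blast
    qed
    ultimately show ?thesis using v False unfolding has_lead_def by (auto simp: add.commute)
  qed
  then show ?thesis using False by (auto simp: shifts_lead_def rep_gen simp del: act.simps)
qed

lemma shifts_lead_word:
  assumes "\<sigma> = 0 \<longrightarrow> k = 0" "\<tau> = 0 \<longrightarrow> n = 0"
  shows "shifts_lead (rep (word i j k n)) (word_shift i j k n)"
proof -
  have id: "shifts_lead (\<lambda>v :: 'k lattice_vec. v) (0, 0, 0, 0)"
    using shifts_lead_id by (simp add: zero_prod_def)
  have S: "shifts_lead (rep (gS ^ k)) (0, 0, int k, 0)"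
  proof (cases "\<sigma> = 0")
    case True
    with assms(1) have "k = 0" by blast
    with id show ?thesis by simp
  next
    case False
    from shifts_lead_power[OF shifts_lead_S[OF this], of k] show ?thesis by simp
  qed
  have T: "shifts_lead (rep (gT ^ n)) (0, 0, 0, int n)"
  proof (cases "\<tau> = 0")
    case True
    with assms(2) have "n = 0" by blast
    with id show ?thesis by simp
  next
    case False
    from shifts_lead_power[OF shifts_lead_T[OF this], of n] show ?thesis by simp
  qed
  have Y: "shifts_lead (rep (gY ^ i)) (if \<zeta> = 0 then 0 else int i, - int i, 0, 0)"
    using shifts_lead_power[OF shifts_lead_Y, of i] by (simp split: if_splits)
  have X: "shifts_lead (rep (gX ^ j)) (0, int j, 0, 0)"
    using shifts_lead_power[OF shifts_lead_X, of j] by simp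
  show ?thesis
    using shifts_lead_comp[OF shifts_lead_comp[OF shifts_lead_comp[OF Y X] S] T]
    by (simp add: word_def word_shift_def rep_mult[abs_def])
qed

text \<open>
  Modulo \<open>J\<close> the element is a combination of reduced words with nonzero coefficients, whose degrees are
  distinct. This also shows that \<open>J\<close> is the whole kernel of the action.
\<close>

lemma not_in_J_shifts_lead:
  assumes "f \<notin> J"
  obtains d where "shifts_lead (rep f) d"
proof -
  let ?W = "{word i j k n | i j k n.
      (\<zeta> = 0 \<longrightarrow> i = 0 \<or> j = 0) \<and> (\<sigma> = 0 \<longrightarrow> k = 0) \<and> (\<tau> = 0 \<longrightarrow> n = 0)}"
  have "f \<in> FA.span (?W \<union> J)"
    by (rule span_reduced_words) (use J_gens in auto)
  then obtain K c where K: "finite K" "K \<subseteq> ?W" and c: "\<And>b. b \<in> K \<Longrightarrow> c b \<noteq> 0"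
    and f: "eqv f (\<Sum>b\<in>K. scl (c b) b)"
    by (rule span_mod_explicit) blast
  have "\<forall>b\<in>K. \<exists>i j k n. b = word i j k n \<and>
      (\<zeta> = 0 \<longrightarrow> i = 0 \<or> j = 0) \<and> (\<sigma> = 0 \<longrightarrow> k = 0) \<and> (\<tau> = 0 \<longrightarrow> n = 0)"
    using K by auto
  then obtain i j k n where word: "\<And>b. b \<in> K \<Longrightarrow> b = word (i b) (j b) (k b) (n b)"
    and red: "\<And>b. b \<in> K \<Longrightarrow> (\<zeta> = 0 \<longrightarrow> i b = 0 \<or> j b = 0) \<and> (\<sigma> = 0 \<longrightarrow> k b = 0) \<and> (\<tau> = 0 \<longrightarrow> n b = 0)"
    by metis
  have rep_f: "rep f = (\<lambda>v e. \<Sum>b\<in>K. c b * rep b v e)"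
  proof (intro ext)
    fix v e
    have "rep (f - (\<Sum>b\<in>K. scl (c b) b)) v e = 0"
      using f by (intro rep_J) (simp add: eqv_def)
    then show "rep f v e = (\<Sum>b\<in>K. c b * rep b v e)"
      by (simp add: rep_diff rep_sum rep_scl)
  qed
  have "K \<noteq> {}" using f assms by (auto simp: eqv_zero_iff)
  moreover have "shifts_lead (rep b) (word_shift (i b) (j b) (k b) (n b))" if "b \<in> K" for b
    using shifts_lead_word[of "k b" "n b" "i b" "j b"] word[OF that] red[OF that] by simp
  moreover have "inj_on (\<lambda>b. word_shift (i b) (j b) (k b) (n b)) K"
  proof (rule inj_onI)
    fix b b' assume b: "b \<in> K" "b' \<in> K"
      and "word_shift (i b) (j b) (k b) (n b) = word_shift (i b') (j b') (k b') (n b')"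
    then have "i b = i b' \<and> j b = j b' \<and> k b = k b' \<and> n b = n b'"
      using red[OF b(1)] red[OF b(2)] by (auto simp: word_shift_def split: if_splits)
    then show "b = b'" using word[OF b(1)] word[OF b(2)] by simp
  qed
  moreover note c
  ultimately obtain d where "shifts_lead (\<lambda>v e. \<Sum>b\<in>K. c b * rep b v e) d"
    using shifts_lead_sum[OF K(1), where c = c and F = rep
        and d = "\<lambda>b. word_shift (i b) (j b) (k b) (n b)"] by blast
  then show thesis by (intro that) (simp only: rep_f)
qed

lemma shifts_lead_not_in_J:
  assumes "shifts_lead (rep f) d"
  shows "f \<notin> J"
proof
  assume "f \<in> J"
  have "has_lead (\<lambda>e. if e = 0 then 1 else 0 :: 'k) 0" by (simp add: has_lead_def)
  with assms have "has_lead (rep f (\<lambda>e. if e = 0 then 1 else 0)) (d + 0)"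
    unfolding shifts_lead_def by blast
  then show False using rep_J[OF \<open>f \<in> J\<close>] by (simp add: has_lead_def)
qed

lemma J_completely_prime:
  assumes "f * g \<in> J"
  shows "f \<in> J \<or> g \<in> J"
proof (rule ccontr)
  assume "\<not> ?thesis"
  then obtain d d' where "shifts_lead (rep f) d" "shifts_lead (rep g) d'"
    using not_in_J_shifts_lead by metis
  then have "shifts_lead (rep (f * g)) (d + d')"
    using shifts_lead_comp[of "rep f" d "rep g" d'] by (simp add: rep_mult[abs_def])
  then show False using assms shifts_lead_not_in_J by blast
qed

lemma one_notin_J: "1 \<notin> J"
  by (rule shifts_lead_not_in_J[of _ 0]) (simp add: shifts_lead_id)

lemma gX_notin_J: "gX \<notin> J"
  by (rule shifts_lead_not_in_J[OF shifts_lead_X])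

lemma gZ_notin_J: "\<zeta> \<noteq> 0 \<Longrightarrow> gZ \<notin> J"
  by (rule shifts_lead_not_in_J[OF shifts_lead_Z])

lemma gS_notin_J: "\<sigma> \<noteq> 0 \<Longrightarrow> gS \<notin> J"
  by (rule shifts_lead_not_in_J[OF shifts_lead_S])

lemma gT_notin_J: "\<tau> \<noteq> 0 \<Longrightarrow> gT \<notin> J"
  by (rule shifts_lead_not_in_J[OF shifts_lead_T])

end

section \<open>Nonzero primes contain a monomial\<close>

context relation_ideal
begin

abbreviation quantum_gens :: "(gen free_monoid \<Rightarrow>\<^sub>0 'k) set" where
  "quantum_gens \<equiv> {gX, gZ, gS, gT}"

text \<open>
  Modulo the relations, \<open>x\<close>, \<open>z\<close>, \<open>s\<close>, \<open>t\<close> generate a quantum affine space: any two of them commute up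
  to a nonzero scalar.
\<close>

inductive_set quantum_monomials :: "(gen free_monoid \<Rightarrow>\<^sub>0 'k) set" where
  one: "1 \<in> quantum_monomials"
| mult: "g \<in> quantum_gens \<Longrightarrow> r \<in> quantum_monomials \<Longrightarrow> g * r \<in> quantum_monomials"

lemma quantum_monomials_mult:
  "r \<in> quantum_monomials \<Longrightarrow> r' \<in> quantum_monomials \<Longrightarrow> r * r' \<in> quantum_monomials"
  by (induction rule: quantum_monomials.induct) (auto simp: mult.assoc intro: quantum_monomials.mult)

lemma quantum_monomials_power: "g \<in> quantum_gens \<Longrightarrow> g ^ n \<in> quantum_monomials"
  by (induction n) (auto intro: quantum_monomials.one quantum_monomials.mult)

lemma quasi_quantum_gens:
  assumes "g \<in> quantum_gens" "h \<in> quantum_gens"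
  obtains c where "c \<noteq> 0" "quasi g h c"
proof -
  have "\<exists>c. c \<noteq> 0 \<and> quasi g h c"
    using assms
    by (elim insertE emptyE; hypsubst)
      ((rule exI, rule conjI[rotated], rule quasi_table, simp)+)
  then show thesis using that by blast
qed

lemma quasi_quantum_monomial:
  assumes "r \<in> quantum_monomials" "g \<in> quantum_gens"
  obtains c where "c \<noteq> 0" "quasi g r c"
  using assms(1)
proof (induction arbitrary: thesis rule: quantum_monomials.induct)
  case one
  then show ?case using quasi_one by (metis zero_neq_one)
next
  case (mult h r)
  obtain c where "c \<noteq> 0" "quasi g r c" using mult.IH by blast
  moreover obtain d where "d \<noteq> 0" "quasi g h d"
    using quasi_quantum_gens[OF assms(2) mult.hyps(1)] by blast
  ultimately show ?case using mult.prems[of "d * c"] quasi_mult by simp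
qed

text \<open>
  Take an element of \<open>I\<close> that is a combination of common eigenvectors for commutation with \<open>x\<close>, \<open>z\<close>,
  \<open>s\<close>, \<open>t\<close>. For a generator \<open>g\<close> whose eigenvalues on two of its terms differ,
  \<open>g u - \<chi> u g\<close> kills one of the terms and keeps the other. The factor \<open>r\<close> on the right collects the
  generators \<open>g\<close> used so far, which avoids rewriting the terms at each step.
\<close>

lemma eigenvector_separation:
  assumes "finite K" "K \<noteq> {}" and "\<And>w. w \<in> K \<Longrightarrow> c w \<noteq> 0"
    and eigen: "\<And>w g. w \<in> K \<Longrightarrow> g \<in> quantum_gens \<Longrightarrow> quasi g w (\<chi> w g)"
    and separated: "\<And>w w'. w \<in> K \<Longrightarrow> w' \<in> K \<Longrightarrow> w \<noteq> w' \<Longrightarrow> \<exists>g\<in>quantum_gens. \<chi> w g \<noteq> \<chi> w' g"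
    and "r \<in> quantum_monomials" and "(\<Sum>w\<in>K. scl (c w) w) * r \<in> I"
  shows "\<exists>w\<in>K. \<exists>r\<in>quantum_monomials. w * r \<in> I"
  using assms
proof (induction "card K" arbitrary: K c r rule: less_induct)
  case less
  note eigen = less.prems(4) and separated = less.prems(5) and r = less.prems(6)
  obtain w0 where w0: "w0 \<in> K" using less.prems(2) by auto
  show ?case
  proof (cases "K = {w0}")
    case True
    then have "scl (c w0) (w0 * r) \<in> I" using less.prems(7) by simp
    then have "w0 * r \<in> I" using scl_mem_iff less.prems(3)[OF w0] by blast
    then show ?thesis using w0 r by blast
  next
    case False
    then obtain w1 where w1: "w1 \<in> K" "w1 \<noteq> w0" using w0 by blast
    then obtain g where g: "g \<in> quantum_gens" and \<chi>: "\<chi> w1 g \<noteq> \<chi> w0 g"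
      using separated w0 by blast
    let ?u = "\<Sum>w\<in>K. scl (c w) w"
    let ?K = "{w \<in> K. \<chi> w g \<noteq> \<chi> w0 g}"
    let ?c = "\<lambda>w. c w * (\<chi> w g - \<chi> w0 g)"
    obtain d where d: "d \<noteq> 0" "quasi g r d" using quasi_quantum_monomial[OF r g] .
    have "?u * (g * r) \<approx> ?u * scl d (r * g)"
      using d by (intro eqv_mult_left) (simp add: quasi_def)
    moreover have "?u * scl d (r * g) \<in> I"
      using scl_mem[OF mult_mem_right[OF less.prems(7), of g], of d] by (simp add: mult.assoc)
    ultimately have ugr: "?u * (g * r) \<in> I" using eqv_mem_iff by blast
    have "g * ?u \<approx> (\<Sum>w\<in>K. scl (c w * \<chi> w g) w) * g"
    proof -
      have "g * ?u = (\<Sum>w\<in>K. scl (c w) (g * w))" by (simp add: sum_distrib_left)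
      also have "\<dots> \<approx> (\<Sum>w\<in>K. scl (c w) (scl (\<chi> w g) (w * g)))"
        using eigen g by (intro eqv_sum eqv_scl) (simp add: quasi_def)
      finally show ?thesis by (simp add: sum_distrib_right)
    qed
    then have "g * ?u * r \<approx> (\<Sum>w\<in>K. scl (c w * \<chi> w g) w) * g * r"
      by (rule eqv_mult_right)
    moreover have "g * ?u * r \<in> I"
      using mult_mem_left[OF less.prems(7), of g] by (simp add: mult.assoc)
    ultimately have "(\<Sum>w\<in>K. scl (c w * \<chi> w g) w) * g * r \<in> I" using eqv_mem_iff by blast
    then have "(\<Sum>w\<in>K. scl (c w * \<chi> w g) w) * (g * r) - scl (\<chi> w0 g) (?u * (g * r)) \<in> I"
      using ugr by (intro diff_mem scl_mem) (simp_all add: mult.assoc)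
    also have "(\<Sum>w\<in>K. scl (c w * \<chi> w g) w) * (g * r) - scl (\<chi> w0 g) (?u * (g * r))
        = (\<Sum>w\<in>K. scl (?c w) w) * (g * r)"
      by (simp add: left_diff_distrib sum_distrib_right FA.scale_sum_right right_diff_distrib
          FA.scale_left_diff_distrib sum_subtractf mult.commute)
    also have "(\<Sum>w\<in>K. scl (?c w) w) = (\<Sum>w\<in>?K. scl (?c w) w)"
      using less.prems(1) by (intro sum.mono_neutral_right) auto
    finally have "(\<Sum>w\<in>?K. scl (?c w) w) * (g * r) \<in> I" .
    moreover have "card ?K < card K"
      using less.prems(1) w0 by (intro psubset_card_mono) auto
    moreover have "g * r \<in> quantum_monomials" using g r by (rule quantum_monomials.mult)
    moreover have "w1 \<in> ?K" using w1 \<chi> by simp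
    ultimately have "\<exists>w\<in>?K. \<exists>r\<in>quantum_monomials. w * r \<in> I"
      using less.prems(1,3) eigen separated by (intro less.hyps[of ?K ?c "g * r"]) auto
    then show ?thesis by blast
  qed
qed

definition ordered_monomial :: "nat \<Rightarrow> nat \<Rightarrow> nat \<Rightarrow> nat \<Rightarrow> gen free_monoid \<Rightarrow>\<^sub>0 'k" where
  "ordered_monomial a b k n = gX ^ a * gZ ^ b * gS ^ k * gT ^ n"

abbreviation ordered_monomials :: "(gen free_monoid \<Rightarrow>\<^sub>0 'k) set" where
  "ordered_monomials \<equiv> range (\<lambda>(a, b, k, n). ordered_monomial a b k n)"

lemma ordered_monomials_sub: "ordered_monomials \<subseteq> quantum_monomials"
  by (auto simp: ordered_monomial_def intro!: quantum_monomials_mult quantum_monomials_power)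

lemma quasi_ordered_monomial:
  "quasi gX (ordered_monomial a b k n) (1 ^ a * p ^ b * inverse l ^ k * inverse m ^ n)"
  "quasi gZ (ordered_monomial a b k n) (inverse p ^ a * 1 ^ b * 1 ^ k * 1 ^ n)"
  "quasi gS (ordered_monomial a b k n) (l ^ a * 1 ^ b * 1 ^ k * q ^ n)"
  "quasi gT (ordered_monomial a b k n) (m ^ a * 1 ^ b * inverse q ^ k * 1 ^ n)"
  unfolding ordered_monomial_def by (intro quasi_mult quasi_power quasi_table)+

text \<open>
  The eigenvalues of \<open>x\<^sup>a z\<^sup>b s\<^sup>k t\<^sup>n\<close> with \<open>e = (a, b, k, n)\<close>; the last branch belongs to \<open>z\<close>.
\<close>

definition weight :: "nat \<times> nat \<times> nat \<times> nat \<Rightarrow> (gen free_monoid \<Rightarrow>\<^sub>0 'k) \<Rightarrow> 'k" where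
  "weight e g = (case e of (a, b, k, n) \<Rightarrow>
    if g = gX then p ^ b * inverse l ^ k * inverse m ^ n
    else if g = gS then l ^ a * q ^ n
    else if g = gT then m ^ a * inverse q ^ k
    else inverse p ^ a)"

lemma power_inj_no_root:
  fixes c :: 'k
  assumes "c \<noteq> 0" "\<And>n. n > 0 \<Longrightarrow> c ^ n \<noteq> 1" "c ^ i = c ^ j"
  shows "i = j"
proof -
  have le: "i = j" if "i \<le> j" "c ^ i = c ^ j" for i j
  proof -
    have "c ^ i * c ^ (j - i) = c ^ i * 1" using that by (metis le_add_diff_inverse mult.right_neutral power_add)
    then have "c ^ (j - i) = 1" using assms(1) by simp
    then show "i = j" using assms(2)[of "j - i"] that(1) by (metis diff_is_0_eq gr0I le_antisym)
  qed
  show ?thesis using le[of i j] le[of j i] assms(3) by (cases "i \<le> j") auto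
qed

lemma free_gen_neq: "g \<noteq> h \<Longrightarrow> free_gen g \<noteq> (free_gen h :: 'g free_monoid \<Rightarrow>\<^sub>0 'b::field)"
  by (metis (no_types) free_gen_def free_monoid.inject list.inject lookup_single_eq
      lookup_single_not_eq zero_neq_one)

lemma gZ_neq: "gZ \<noteq> (free_gen g :: gen free_monoid \<Rightarrow>\<^sub>0 'k)"
proof
  assume "gZ = (free_gen g :: gen free_monoid \<Rightarrow>\<^sub>0 'k)"
  then have "Poly_Mapping.lookup gZ (Word [g]) = Poly_Mapping.lookup (free_gen g :: _ \<Rightarrow>\<^sub>0 'k) (Word [g])"
    by simp
  then show False
    by (simp add: free_gen_def mult_single lookup_minus lookup_single plus_free_monoid_def when_def)
qed

lemma quasi_weight:
  "g \<in> quantum_gens \<Longrightarrow> quasi g (ordered_monomial a b k n) (weight (a, b, k, n) g)"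
  using quasi_ordered_monomial[of a b k n]
  by (auto simp: weight_def free_gen_neq gZ_neq)

text \<open>
  The system of equations is triangular: \<open>z\<close> gives \<open>a\<close> through the powers of \<open>p\<close>, then \<open>s\<close> and \<open>t\<close>
  give \<open>n\<close> and \<open>k\<close> through the powers of \<open>q\<close>, and finally \<open>x\<close> gives \<open>b\<close>.
\<close>

lemma weight_separates:
  assumes "\<And>g. g \<in> quantum_gens \<Longrightarrow> weight e g = weight e' g"
  shows "e = e'"
proof -
  obtain a b k n where e: "e = (a, b, k, n)" by (cases e)
  obtain a' b' k' n' where e': "e' = (a', b', k', n')" by (cases e')
  have "a = a'"
    using assms[of gZ] p_no_root
    by (intro power_inj_no_root[of p])
      (auto simp: e e' weight_def gZ_neq power_inverse)
  moreover have "n = n'"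
    using assms[of gS] q_no_root \<open>a = a'\<close>
    by (intro power_inj_no_root[of q]) (auto simp: e e' weight_def free_gen_neq)
  moreover have "k = k'"
    using assms[of gT] q_no_root \<open>a = a'\<close>
    by (intro power_inj_no_root[of q]) (auto simp: e e' weight_def free_gen_neq power_inverse)
  moreover have "b = b'"
    using assms[of gX] p_no_root \<open>k = k'\<close> \<open>n = n'\<close>
    by (intro power_inj_no_root[of p]) (auto simp: e e' weight_def)
  ultimately show ?thesis by (simp add: e e')
qed

lemma quasi_left_absorb:
  assumes "quasi g a c"
  shows "g * (a * u) \<approx> scl c (a * (g * u))"
  using eqv_mult_right[OF assms[unfolded quasi_def], of u] by (simp add: mult.assoc)

lemma ordered_span_gen:
  assumes "g \<in> quantum_gens" "f \<in> FA.span (ordered_monomials \<union> I)"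
  shows "g * f \<in> FA.span (ordered_monomials \<union> I)"
  using assms(2)
proof (rule span_mult_left)
  fix w assume "w \<in> ordered_monomials"
  then obtain a b k n where w: "w = ordered_monomial a b k n" by auto
  have mem: "scl c (ordered_monomial a b k n) \<in> FA.span (ordered_monomials \<union> I)" for c a b k n
    by (intro FA.span_scale FA.span_base UnI1 range_eqI[of _ _ "(a, b, k, n)"]) simp
  consider "g = gX" | "g = gZ" | "g = gS" | "g = gT" using assms(1) by auto
  then show "g * w \<in> FA.span (ordered_monomials \<union> I)"
  proof cases
    case 1
    have "gX * w = scl 1 (ordered_monomial (Suc a) b k n)"
      by (simp add: w ordered_monomial_def mult.assoc)
    then show ?thesis using mem 1 by metis
  next
    case 2
    have "quasi gZ (gX ^ a) (inverse p ^ a)" by (intro quasi_power quasi_table)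
    from quasi_left_absorb[OF this, of "gZ ^ b * gS ^ k * gT ^ n"]
    have "gZ * w \<approx> scl (inverse p ^ a) (ordered_monomial a (Suc b) k n)"
      by (simp add: w ordered_monomial_def mult.assoc)
    then show ?thesis unfolding 2 by (rule span_eqv) (rule mem)
  next
    case 3
    have "quasi gS (gX ^ a * gZ ^ b) (l ^ a * 1 ^ b)" by (intro quasi_mult quasi_power quasi_table)
    from quasi_left_absorb[OF this, of "gS ^ k * gT ^ n"]
    have "gS * w \<approx> scl (l ^ a * 1 ^ b) (ordered_monomial a b (Suc k) n)"
      by (simp add: w ordered_monomial_def mult.assoc)
    then show ?thesis unfolding 3 by (rule span_eqv) (rule mem)
  next
    case 4
    have "quasi gT (gX ^ a * gZ ^ b * gS ^ k) (m ^ a * 1 ^ b * inverse q ^ k)"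
      by (intro quasi_mult quasi_power quasi_table)
    from quasi_left_absorb[OF this, of "gT ^ n"]
    have "gT * w \<approx> scl (m ^ a * 1 ^ b * inverse q ^ k) (ordered_monomial a b k (Suc n))"
      by (simp add: w ordered_monomial_def mult.assoc)
    then show ?thesis unfolding 4 by (rule span_eqv) (rule mem)
  qed
qed

text \<open>
  In the torus \<open>y\<close> has denominator \<open>x\<close>. Concretely, \<open>x\<^sup>N\<^sup>+\<^sup>1 y\<close> is a scalar multiple of \<open>(y x) x\<^sup>N\<close> plus a
  scalar multiple of \<open>x\<^sup>N\<close>, and \<open>y x = (z - 1) / (p - 1)\<close>.
\<close>

lemma clear_denominator: "\<exists>N. gX ^ N * f \<in> FA.span (ordered_monomials \<union> I)"
proof (induction f rule: free_algebra_induct)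
  let ?B = "FA.span (ordered_monomials \<union> I)"
  have X: "gX * f \<in> ?B" if "f \<in> ?B" for f using that by (rule ordered_span_gen[rotated]) simp
  have raise: "gX ^ (M + N) * f \<in> ?B" if "gX ^ N * f \<in> ?B" for M N f
    using that by (induction M) (auto simp: mult.assoc intro: X)
  {
    case one
    have "1 \<in> ?B"
      by (intro FA.span_base UnI1 range_eqI[of _ _ "(0, 0, 0, 0)"]) (simp add: ordered_monomial_def)
    then show ?case by (intro exI[of _ 0]) simp
  next
    case (scl c f)
    then show ?case by (auto intro: FA.span_scale)
  next
    case (add f g)
    then obtain N M where "gX ^ N * f \<in> ?B" "gX ^ M * g \<in> ?B" by blast
    then have "gX ^ (M + N) * f \<in> ?B" "gX ^ (N + M) * g \<in> ?B" using raise by blast+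
    then show ?case
      by (intro exI[of _ "M + N"]) (simp add: distrib_left add.commute FA.span_add)
  next
    case (gen g f)
    then obtain N where N: "gX ^ N * f \<in> ?B" by blast
    have commuting: "\<exists>N. gX ^ N * (h * f) \<in> ?B"
      if h: "h \<in> quantum_gens" for h
    proof -
      obtain d where "d \<noteq> 0" and d: "quasi h (gX ^ N) d"
        using quasi_quantum_monomial[OF quantum_monomials_power h, of gX N] by auto
      from quasi_sym[OF d \<open>d \<noteq> 0\<close>]
      have "gX ^ N * (h * f) \<approx> scl (inverse d) (h * (gX ^ N * f))" by (rule quasi_left_absorb)
      then have "gX ^ N * (h * f) \<in> ?B"
        by (rule span_eqv) (rule FA.span_scale[OF ordered_span_gen[OF h N]])
      then show ?thesis ..
    qed
    show ?case
    proof (cases g)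
      case X
      then have "gX ^ N * (free_gen g * f) = gX * (gX ^ N * f)"
        by (simp add: mult.assoc[symmetric] power_commutes)
      then show ?thesis using X N ordered_span_gen[of gX "gX ^ N * f"] by (intro exI[of _ N]) simp
    next
      case Y
      have "gX ^ Suc N * (gY * f) \<approx>
          (scl (p ^ Suc N) (gY * gX ^ Suc N) + scl (qnum (Suc N)) (gX ^ N)) * f"
        using eqv_mult_right[OF xpow_y[of N], of f] by (simp add: mult.assoc)
      also have "\<dots> = scl (p ^ Suc N) ((gY * gX) * (gX ^ N * f)) + scl (qnum (Suc N)) (gX ^ N * f)"
        by (simp add: distrib_right mult.assoc)
      also have "\<dots> \<approx> scl (p ^ Suc N) (scl (1 / (p - 1)) (gZ - 1) * (gX ^ N * f))
          + scl (qnum (Suc N)) (gX ^ N * f)"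
        by (intro eqv_add eqv_scl eqv_mult_right yx_eqv eqv_refl)
      also have "\<dots> = scl (p ^ Suc N / (p - 1)) (gZ * (gX ^ N * f) - gX ^ N * f)
          + scl (qnum (Suc N)) (gX ^ N * f)"
        by (simp add: left_diff_distrib)
      finally have "gX ^ Suc N * (gY * f) \<in> ?B"
        by (rule span_eqv)
          (intro FA.span_add FA.span_scale FA.span_diff ordered_span_gen N; simp)
      then show ?thesis unfolding Y by blast
    next
      case S
      then show ?thesis using commuting[of gS] by auto
    next
      case T
      then show ?thesis using commuting[of gT] by auto
    qed
  }
qed

lemma normal_element:
  assumes "g \<in> {gZ, gS, gT}"
  shows "\<exists>r'. g * r \<approx> r' * g"
proof (induction r rule: free_algebra_induct)
  case one
  then show ?case by (intro exI[of _ 1]) simp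
next
  case (gen h f)
  then obtain r' where r': "g * f \<approx> r' * g" by blast
  have "\<exists>c. quasi g (free_gen h) c"
    using assms by (cases h) (auto intro: quasi_table)
  then obtain c where "quasi g (free_gen h) c" ..
  from quasi_left_absorb[OF this, of f] eqv_scl[OF eqv_mult_left[OF r']]
  have "g * (free_gen h * f) \<approx> scl c (free_gen h * (r' * g))" by (rule eqv_trans)
  then show ?case by (intro exI[of _ "scl c (free_gen h * r')"]) (simp add: mult.assoc)
next
  case (scl c f)
  then obtain r' where "g * f \<approx> r' * g" by blast
  from eqv_scl[OF this, of c] show ?case by (intro exI[of _ "scl c r'"]) simp
next
  case (add f f')
  then obtain r r' where "g * f \<approx> r * g" "g * f' \<approx> r' * g" by blast
  from eqv_add[OF this] show ?case by (intro exI[of _ "r + r'"]) (simp add: distrib_left distrib_right)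
qed

end

locale proper_prime_relation_ideal = relation_ideal +
  assumes prime: "(\<And>r. f * r * g \<in> I) \<Longrightarrow> f \<in> I \<or> g \<in> I"
    and one_notin: "1 \<notin> I"
begin

text \<open>
  Since \<open>g r\<close> is congruent to some \<open>r' g\<close>, from \<open>g u \<in> I\<close> follows \<open>g r u \<in> I\<close> for all \<open>r\<close>.
\<close>

lemma normal_prime:
  assumes "g \<in> {gZ, gS, gT}" "g * u \<in> I"
  shows "g \<in> I \<or> u \<in> I"
proof (rule prime)
  fix r
  obtain r' where "g * r \<approx> r' * g" using normal_element[OF assms(1)] by blast
  then have "g * r * u \<approx> r' * g * u" by (rule eqv_mult_right)
  moreover have "r' * g * u \<in> I" using mult_mem_left[OF assms(2), of r'] by (simp add: mult.assoc)
  ultimately show "g * r * u \<in> I" using eqv_mem_iff by blast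
qed

text \<open>
  From \<open>x\<^sup>n\<^sup>+\<^sup>1 \<in> I\<close> the commutation rule of \<open>x\<^sup>n\<^sup>+\<^sup>1\<close> with \<open>y\<close> gives a nonzero multiple of \<open>x\<^sup>n\<close> in \<open>I\<close>,
  and so on down to \<open>1\<close>.
\<close>

lemma gX_power_notin: "gX ^ n \<notin> I"
proof (induction n)
  case 0
  then show ?case using one_notin by simp
next
  case (Suc n)
  show ?case
  proof
    assume x: "gX ^ Suc n \<in> I"
    have "scl (p ^ Suc n) (gY * gX ^ Suc n) + scl (qnum (Suc n)) (gX ^ n) \<in> I"
      using eqv_mem_iff[OF xpow_y[of n]] mult_mem_right[OF x] by blast
    from diff_mem[OF this scl_mem[OF mult_mem_left[OF x, of gY], of "p ^ Suc n"]]
    have "scl (qnum (Suc n)) (gX ^ n) \<in> I" by simp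
    then have "gX ^ n \<in> I" using scl_mem_iff qnum_nonzero by blast
    then show False using Suc by blast
  qed
qed

text \<open>
  Letters \<open>z\<close>, \<open>s\<close>, \<open>t\<close> are moved to the front and cancelled by \<open>normal_prime\<close>, letters \<open>x\<close> are
  collected in the power in front.
\<close>

lemma quantum_monomial_notin:
  assumes "gZ \<notin> I" "gS \<notin> I" "gT \<notin> I" and "r \<in> quantum_monomials"
  shows "gX ^ k * r \<notin> I"
  using assms(4)
proof (induction arbitrary: k rule: quantum_monomials.induct)
  case one
  then show ?case using gX_power_notin by simp
next
  case (mult g r)
  show ?case
  proof (cases "g = gX")
    case True
    then have "gX ^ k * (g * r) = gX ^ Suc k * r"
      by (simp add: mult.assoc[symmetric] power_commutes)
    then show ?thesis using mult.IH by (simp del: power_Suc)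
  next
    case False
    then have g: "g \<in> {gZ, gS, gT}" using mult.hyps by blast
    obtain c where "c \<noteq> 0" "quasi g (gX ^ k) c"
      using quasi_quantum_monomial[OF quantum_monomials_power mult.hyps(1), of gX k] by auto
    then have eqv: "g * (gX ^ k * r) \<approx> scl c (gX ^ k * (g * r))" by (simp add: quasi_left_absorb)
    show ?thesis
    proof
      assume "gX ^ k * (g * r) \<in> I"
      then have "g * (gX ^ k * r) \<in> I" using eqv_mem_iff[OF eqv] scl_mem by blast
      then show False using normal_prime[OF g] g assms(1-3) mult.IH by blast
    qed
  qed
qed

text \<open>
  The combination of monomials obtained from an element outside the relation ideal has at least one
  term, because the relation ideal is completely prime and does not contain \<open>x\<close>.
\<close>

theorem prime_contains_normal_generator:
  assumes J: "quotient_model.J p q l m 1 1 1 \<subset> I"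
  shows "gZ \<in> I \<or> gS \<in> I \<or> gT \<in> I"
proof (rule ccontr)
  assume no: "\<not> ?thesis"
  interpret M: quotient_model p q l m 1 1 1 by unfold_locales
  obtain f where f: "f \<in> I" "f \<notin> M.J" using J by blast
  obtain N where "gX ^ N * f \<in> FA.span (ordered_monomials \<union> M.J)"
    using M.clear_denominator[of f] unfolding M.ordered_monomial_def ordered_monomial_def by blast
  then obtain K c where K: "finite K" "K \<subseteq> ordered_monomials"
    and c: "\<And>b. b \<in> K \<Longrightarrow> c b \<noteq> 0" and eq: "M.eqv (gX ^ N * f) (\<Sum>b\<in>K. scl (c b) b)"
    by (rule M.span_mod_explicit) blast
  have "gX ^ n * f \<notin> M.J" for n
    by (induction n) (use f(2) M.gX_notin_J M.J_completely_prime in \<open>auto simp: mult.assoc\<close>)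
  then have "K \<noteq> {}" using eq by (auto simp: M.eqv_zero_iff)
  have "gX ^ N * f - (\<Sum>b\<in>K. scl (c b) b) \<in> I" using eq J unfolding M.eqv_def by blast
  then have sum: "(\<Sum>b\<in>K. scl (c b) b) * 1 \<in> I"
    using eqv_mem_iff[of "gX ^ N * f"] mult_mem_left[OF f(1), of "gX ^ N"] unfolding eqv_def by simp
  have "\<forall>w\<in>K. \<exists>e. w = (\<lambda>(a, b, k, n). ordered_monomial a b k n) e" using K(2) by blast
  then obtain e where e: "\<And>w. w \<in> K \<Longrightarrow> w = (\<lambda>(a, b, k, n). ordered_monomial a b k n) (e w)"
    by metis
  have "\<exists>w\<in>K. \<exists>r\<in>quantum_monomials. w * r \<in> I"
  proof (rule eigenvector_separation[OF K(1) \<open>K \<noteq> {}\<close> c _ _ quantum_monomials.one sum])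
    show "quasi g w (weight (e w) g)" if "w \<in> K" "g \<in> quantum_gens" for w g
      using quasi_weight[OF that(2)] e[OF that(1)] by (auto split: prod.splits)
    show "\<exists>g\<in>quantum_gens. weight (e w) g \<noteq> weight (e w') g"
      if "w \<in> K" "w' \<in> K" "w \<noteq> w'" for w w'
      using weight_separates[of "e w" "e w'"] e[OF that(1)] e[OF that(2)] that(3) by metis
  qed
  then obtain w r where "w \<in> ordered_monomials" "r \<in> quantum_monomials" "w * r \<in> I" using K(2) by blast
  then have "gX ^ 0 * (w * r) \<in> I" "w * r \<in> quantum_monomials"
    using ordered_monomials_sub quantum_monomials_mult by (simp, blast)
  then show False using quantum_monomial_notin no by blast
qed

end

section \<open>Ideals of the quotient algebra\<close>

text \<open>
  Principal ideals of a quotient, read off in the ring above: \<open>J\<close> is the smallest ideal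
  containing \<open>I\<close> and \<open>n\<close>, stated through the minimality property \<open>min\<close>.
\<close>

lemma Idl_quotient_image:
  fixes R (structure)
  assumes R: "ring R" and I: "ideal I R" and J: "ideal J R" and IJ: "I \<subseteq> J"
    and n: "n \<in> J" and min: "\<And>H. ideal H R \<Longrightarrow> I \<subseteq> H \<Longrightarrow> n \<in> H \<Longrightarrow> J \<subseteq> H"
    and f: "f \<in> carrier R"
  shows "I +>\<^bsub>R\<^esub> f \<in> Idl\<^bsub>R Quot I\<^esub> {I +>\<^bsub>R\<^esub> n} \<longleftrightarrow> f \<in> J"
proof -
  interpret ring R by fact
  interpret I: ideal I R by fact
  interpret J: ideal J R by fact
  interpret Q: ring "R Quot I" by (rule I.quotient_is_ring)
  interpret \<pi>: ring_hom_ring R "R Quot I" "(+>) I" by (rule I.rcos_ring_hom_ring)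
  have nR: "n \<in> carrier R" using n J.Icarr by blast
  have closed: "I +> f \<in> carrier (R Quot I)" if "f \<in> carrier R" for f using that by simp
  let ?D = "Idl\<^bsub>R Quot I\<^esub> {I +> n}"
  have D: "ideal ?D (R Quot I)" using closed[OF nR] by (intro Q.genideal_ideal) simp
  let ?V = "{r \<in> carrier R. I +> r \<in> ?D}"
  have V: "ideal ?V R" by (rule \<pi>.ideal_vimage[OF D])
  have "I \<subseteq> ?V"
  proof
    fix i assume "i \<in> I"
    then have "I +> i = \<zero>\<^bsub>R Quot I\<^esub>" unfolding FactRing_def by (simp only: I.a_rcos_const ring.simps)
    moreover have "\<zero>\<^bsub>R Quot I\<^esub> \<in> ?D"
      using D by (simp add: additive_subgroup.zero_closed ideal.axioms(1))
    ultimately show "i \<in> ?V"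
      using I.Icarr[OF \<open>i \<in> I\<close>] by simp
  qed
  moreover have "n \<in> ?V" using nR Q.genideal_self'[OF closed[OF nR]] by simp
  ultimately have "J \<subseteq> ?V" by (intro min V)
  moreover have "?D \<subseteq> (+>) I ` J"
  proof (rule Q.genideal_minimal)
    show "ideal ((+>) I ` J) (R Quot I)" by (rule ring_ideal_imp_quot_ideal[OF I J])
  qed (use n in auto)
  moreover have "f \<in> J" if f_image: "I +> f \<in> (+>) I ` J"
  proof -
    obtain j where j: "j \<in> J" "I +> f = I +> j" using f_image by (rule imageE)
    have "f \<in> I +> f" using f I.a_rcos_self by blast
    then have "f \<in> I +> j" using j(2) by simp
    then obtain i where "i \<in> I" "f = i \<oplus> j" unfolding a_r_coset_def' by blast
    then show ?thesis using IJ j(1) by blast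
  qed
  ultimately show ?thesis by blast
qed

context quantum_params
begin

abbreviation "\<pi> f \<equiv> rel_ideal p q l m +>\<^bsub>free_algebra\<^esub> (f :: gen free_monoid \<Rightarrow>\<^sub>0 'k)"

sublocale A: ring "alg p q l m" by (rule ring_alg)

sublocale \<pi>: ring_hom_ring free_algebra "alg p q l m" "\<lambda>f. \<pi> f"
  unfolding alg_def by (rule ideal.rcos_ring_hom_ring[OF ideal_rel_ideal])

lemma carrier_free_algebra [simp]: "carrier free_algebra = UNIV"
  by (simp add: free_algebra_def)

lemma alg_elem: "a \<in> carrier (alg p q l m) \<Longrightarrow> \<exists>f. a = \<pi> f"
  unfolding alg_def FactRing_def A_RCOSETS_def' partial_object.simps carrier_free_algebra by blast

lemma pi_closed: "\<pi> f \<in> carrier (alg p q l m)"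
  using \<pi>.hom_closed by simp

lemma pi_mult: "\<pi> f \<otimes>\<^bsub>alg p q l m\<^esub> \<pi> g = \<pi> (f * g)"
  using \<pi>.hom_mult[of f g] by (simp add: free_algebra_def)

lemma alg_z_eq: "alg_z p q l m = \<pi> gZ"
proof -
  have "gX * gY \<ominus>\<^bsub>free_algebra\<^esub> gY * gX = (gZ :: gen free_monoid \<Rightarrow>\<^sub>0 'k)"
    using abelian_group.minus_equality[OF ring.is_abelian_group[OF ring_free_algebra],
        of "- (gY * gX)" "gY * gX :: gen free_monoid \<Rightarrow>\<^sub>0 'k"]
    by (simp add: free_algebra_def a_minus_def)
  moreover have "\<pi> (a \<ominus>\<^bsub>free_algebra\<^esub> b) = \<pi> a \<ominus>\<^bsub>alg p q l m\<^esub> \<pi> b" for a b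
    by (simp add: a_minus_def)
  ultimately show ?thesis
    unfolding alg_z_def alg_gen_def pi_mult by metis
qed

lemma J_trivial: "quotient_model.J p q l m 1 1 1 = rel_ideal p q l m"
proof -
  interpret M: quotient_model p q l m 1 1 1 by unfold_locales
  show ?thesis by (simp add: M.J_def rel_ideal_def)
qed

lemma pi_zero_iff: "\<pi> f = \<zero>\<^bsub>alg p q l m\<^esub> \<longleftrightarrow> f \<in> rel_ideal p q l m"
proof -
  interpret I: ideal "rel_ideal p q l m" free_algebra by (rule ideal_rel_ideal)
  have "\<zero>\<^bsub>alg p q l m\<^esub> = rel_ideal p q l m"
    unfolding alg_def FactRing_def by (simp only: ring.simps)
  moreover have "\<pi> f = rel_ideal p q l m \<Longrightarrow> f \<in> rel_ideal p q l m"
    by (rule I.rcos_const_imp_mem) simp_all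
  moreover have "f \<in> rel_ideal p q l m \<Longrightarrow> \<pi> f = rel_ideal p q l m"
    by (rule I.a_rcos_const)
  ultimately show ?thesis by metis
qed

lemma completely_prime_alg:
  assumes P: "ideal P (alg p q l m)" and J: "\<And>f. \<pi> f \<in> P \<longleftrightarrow> f \<in> J"
    and "1 \<notin> J" and "\<And>f g. f * g \<in> J \<Longrightarrow> f \<in> J \<or> g \<in> J"
  shows "nc_prime_ideal P (alg p q l m)"
proof (rule completely_prime_imp_nc_prime_ideal[OF P])
  show "P \<noteq> carrier (alg p q l m)" using J[of 1] \<open>1 \<notin> J\<close> pi_closed[of 1] by blast
  fix a b assume "a \<in> carrier (alg p q l m)" "b \<in> carrier (alg p q l m)"
    and ab: "a \<otimes>\<^bsub>alg p q l m\<^esub> b \<in> P"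
  then obtain f g where "a = \<pi> f" "b = \<pi> g" using alg_elem by blast
  then show "a \<in> P \<or> b \<in> P" using ab assms(4) by (simp add: pi_mult J)
qed

lemma nonzero_prime_contains:
  assumes P: "nc_prime_ideal P (alg p q l m)" and P0: "P \<noteq> {\<zero>\<^bsub>alg p q l m\<^esub>}"
  shows "\<pi> gZ \<in> P \<or> \<pi> gS \<in> P \<or> \<pi> gT \<in> P"
proof -
  have ideal: "ideal P (alg p q l m)" and proper: "P \<noteq> carrier (alg p q l m)"
    using P by (auto simp: nc_prime_ideal_def)
  interpret P: ideal P "alg p q l m" by fact
  let ?I = "{f. \<pi> f \<in> P}"
  have I: "ideal ?I free_algebra" using \<pi>.ideal_vimage[OF ideal] by simp
  have sub: "rel_ideal p q l m \<subseteq> ?I"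
  proof
    fix f assume "f \<in> rel_ideal p q l m"
    then have "\<pi> f = \<zero>\<^bsub>alg p q l m\<^esub>" by (simp only: pi_zero_iff)
    with P.zero_closed show "f \<in> ?I" by simp
  qed
  interpret proper_prime_relation_ideal p q l m ?I
  proof (intro proper_prime_relation_ideal.intro relation_ideal.intro quantum_params_axioms
      falg_ideal.intro I relation_ideal_axioms.intro proper_prime_relation_ideal_axioms.intro)
    show "relators p q l m \<subseteq> ?I"
      using sub ring.genideal_self[OF ring_free_algebra, of "relators p q l m"]
      by (auto simp: rel_ideal_def)
    show "f \<in> ?I \<or> g \<in> ?I" if "\<And>r. f * r * g \<in> ?I" for f g
    proof -
      have "\<pi> f \<otimes>\<^bsub>alg p q l m\<^esub> a \<otimes>\<^bsub>alg p q l m\<^esub> \<pi> g \<in> P" if "a \<in> carrier (alg p q l m)" for a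
        using alg_elem[OF that] \<open>\<And>r. f * r * g \<in> ?I\<close> by (auto simp: pi_mult)
      from nc_prime_ideal_elementwise[OF ring_alg P pi_closed pi_closed this]
      show ?thesis by simp
    qed
    have "\<pi> 1 = \<one>\<^bsub>alg p q l m\<^esub>" using \<pi>.hom_one by (simp add: free_algebra_def)
    then show "1 \<notin> ?I" using P.one_imp_carrier proper by auto
  qed
  obtain a where "a \<in> P" "a \<noteq> \<zero>\<^bsub>alg p q l m\<^esub>"
    using P0 P.zero_closed by blast
  then obtain f where "\<pi> f \<in> P" "f \<notin> rel_ideal p q l m"
    using alg_elem P.Icarr pi_zero_iff by metis
  then have "quotient_model.J p q l m 1 1 1 \<subset> ?I" using sub unfolding J_trivial by blast
  from prime_contains_normal_generator[OF this] show ?thesis by simp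
qed

text \<open>
  The three tuples are the cases of \<open>quotient_model\<close> in which exactly the element \<open>n\<close> is killed.
\<close>

lemma normal_generator_prime:
  assumes "(\<zeta>, \<sigma>, \<tau>, n) \<in> {(0, 1, 1, gZ), (1, 0, 1, gS), (1, 1, 0, gT)}"
  shows "nc_prime_ideal (Idl\<^bsub>alg p q l m\<^esub> {\<pi> n}) (alg p q l m)"
    and "\<pi> f \<in> Idl\<^bsub>alg p q l m\<^esub> {\<pi> n} \<longleftrightarrow> f \<in> quotient_model.J p q l m \<zeta> \<sigma> \<tau>"
proof -
  interpret M: quotient_model p q l m \<zeta> \<sigma> \<tau> by unfold_locales
  have mem: "\<pi> f \<in> Idl\<^bsub>alg p q l m\<^esub> {\<pi> n} \<longleftrightarrow> f \<in> M.J" for f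
    unfolding alg_def
  proof (rule Idl_quotient_image[OF ring_free_algebra ideal_rel_ideal M.J_ideal])
    show "rel_ideal p q l m \<subseteq> M.J"
      unfolding rel_ideal_def by (rule ring.genideal_minimal[OF ring_free_algebra M.J_ideal M.J_gens(1)])
    show "n \<in> M.J" using assms M.J_gens by auto
    show "M.J \<subseteq> H" if "ideal H free_algebra" "rel_ideal p q l m \<subseteq> H" "n \<in> H" for H
    proof (rule M.J_minimal[OF that(1)])
      show "relators p q l m \<subseteq> H"
        using that(2) ring.genideal_self[OF ring_free_algebra, of "relators p q l m"]
        by (auto simp: rel_ideal_def)
    qed (use assms that(3) in auto)
  qed simp
  then show "\<pi> f \<in> Idl\<^bsub>alg p q l m\<^esub> {\<pi> n} \<longleftrightarrow> f \<in> M.J" .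
  show "nc_prime_ideal (Idl\<^bsub>alg p q l m\<^esub> {\<pi> n}) (alg p q l m)"
    using pi_closed mem M.one_notin_J M.J_completely_prime
    by (intro completely_prime_alg[of _ M.J] A.genideal_ideal) auto
qed

lemma zero_prime: "nc_prime_ideal {\<zero>\<^bsub>alg p q l m\<^esub>} (alg p q l m)"
proof -
  interpret M: quotient_model p q l m 1 1 1 by unfold_locales
  show ?thesis
    using M.one_notin_J M.J_completely_prime
    by (intro completely_prime_alg[of _ M.J] A.zeroideal) (auto simp: J_trivial pi_zero_iff)
qed

theorem height_one_primes:
  "{P. nc_prime_ideal P (alg p q l m) \<and> ideal_height (alg p q l m) P = 1} =
    (\<lambda>n. Idl\<^bsub>alg p q l m\<^esub> {n}) ` {\<pi> gZ, \<pi> gS, \<pi> gT}"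
proof (rule height_one_primes_eq_principal[OF ring_alg zero_prime])
  interpret M: quotient_model p q l m 1 1 1 by unfold_locales
  interpret MZ: quotient_model p q l m 0 1 1 by unfold_locales
  interpret MS: quotient_model p q l m 1 0 1 by unfold_locales
  interpret MT: quotient_model p q l m 1 1 0 by unfold_locales
  note prime = normal_generator_prime[of 0 1 1 gZ] normal_generator_prime[of 1 0 1 gS]
    normal_generator_prime[of 1 1 0 gT]
  show "{\<pi> gZ, \<pi> gS, \<pi> gT} \<subseteq> carrier (alg p q l m)" using pi_closed by blast
  show "\<zero>\<^bsub>alg p q l m\<^esub> \<notin> {\<pi> gZ, \<pi> gS, \<pi> gT}"
    using pi_zero_iff M.gZ_notin_J M.gS_notin_J M.gT_notin_J unfolding J_trivial
    by (metis insertE singletonD zero_neq_one)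
  show "nc_prime_ideal (Idl\<^bsub>alg p q l m\<^esub> {n}) (alg p q l m)" if "n \<in> {\<pi> gZ, \<pi> gS, \<pi> gT}" for n
    using that prime by auto
  show "n = n'" if "n \<in> {\<pi> gZ, \<pi> gS, \<pi> gT}" "n' \<in> {\<pi> gZ, \<pi> gS, \<pi> gT}"
    "n \<in> Idl\<^bsub>alg p q l m\<^esub> {n'}" for n n'
    using that prime MZ.gS_notin_J MZ.gT_notin_J MS.gZ_notin_J MS.gT_notin_J
      MT.gZ_notin_J MT.gS_notin_J by auto
  show "\<exists>n\<in>{\<pi> gZ, \<pi> gS, \<pi> gT}. n \<in> P"
    if "nc_prime_ideal P (alg p q l m)" "P \<noteq> {\<zero>\<^bsub>alg p q l m\<^esub>}" for P
    using nonzero_prime_contains[OF that] by blast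
qed

end

theorem corollary1p1:
  fixes p q l m :: "'k::field"
  assumes "p \<noteq> 0" and "q \<noteq> 0" and "l \<noteq> 0" and "m \<noteq> 0"
    and "\<not> (\<exists>n>0. p ^ n = 1)"
    and "\<not> (\<exists>n>0. q ^ n = 1)"
  shows "{P. nc_prime_ideal P (alg p q l m) \<and> ideal_height (alg p q l m) P = 1} =
    {Idl\<^bsub>alg p q l m\<^esub> {alg_z p q l m},
     Idl\<^bsub>alg p q l m\<^esub> {alg_gen p q l m S},
     Idl\<^bsub>alg p q l m\<^esub> {alg_gen p q l m T}}"
proof -
  interpret quantum_params p q l m by unfold_locales (use assms in blast)+
  show ?thesis using height_one_primes by (simp add: alg_z_eq alg_gen_def)
qed

end
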